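(* If $n>3$, the pair $(\mathrm{Spin}(n,1),\mathrm{Spin}(n))$ has a unique reductive splitting $$\mathfrak{spin}(n,1)=\mathfrak{spin}(n)\oplus\mathfrak{m}_0 .$$ If $n=3$, there is a one-parameter family of reductive splittings of the pair $(\mathrm{Spin}(3,1),\mathrm{Spin}(3))$ $$\mathfrak{spin}(3,1)=\mathfrak{spin}(3)\oplus\mathfrak{m}_\beta,\qquad \beta\in\mathbb{R}.$$ The parameter $\beta$ is called the Barbero--Immirzi parameter of the splitting.
   Context: $\mathrm{Spin}(n,1)$ denotes the connected component of the identity of the spin group of signature $(n,1)$ ($n$ pluses, one minus), with double covering $\ell\colon\mathrm{Spin}(n,1)\to\mathrm{SO}(n,1)$ onto the connected component of the identity of the special orthogonal group. Let $e_0,\dots,e_n$ be a basis of $\mathbb{R}^{n+1}$ with $\eta(e_0,e_0)=-1$, $\eta(e_i,e_j)=\delta_{ij}$ for $i,j\ge1$, $\eta(e_0,e_i)=0$ for $i\ge 1$, where $\eta$ is the symmetric bilinear form of signature $(n,1)$. $\mathrm{Spin}(n)$ is regarded as a closed Lie subgroup of $\mathrm{Spin}(n,1)$ via the inclusion of Clifford algebras induced by $\langle e_1,\dots,e_n\rangle\hookrightarrow\mathbb{R}^{n+1}$; its elements $S$ are characterized by $\ell(S)e_0=e_0$. Correspondingly the Lie algebra $\mathfrak{spin}(n)$ is a subalgebra of $\mathfrak{spin}(n,1)$: denoting by $\mathbf{e}_a$ the image of $e_a$ in the Clifford algebra, $\mathfrak{spin}(n,1)$ is the real span of the products $\mathbf{e}_a\mathbf{e}_b$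 with $0\le a<b\le n$, and $\mathfrak{spin}(n)$ is the span of the $\mathbf{e}_i\mathbf{e}_j$ with $1\le i<j\le n$. The adjoint action of $S\in\mathrm{Spin}(n,1)$ is $\mathbf{e}_a\mathbf{e}_b\mapsto S\,\mathbf{e}_a\mathbf{e}_b\,S^{-1}$. Reductive splitting: for a Lie group $G$ with Lie algebra $\mathfrak{g}$ and a closed Lie subgroup $H\subset G$ with Lie algebra $\mathfrak{h}\subset\mathfrak{g}$, a reductive splitting of the pair $(G,H)$ is a vector space splitting $\mathfrak{g}=\mathfrak{h}\oplus\mathfrak{m}$, with $\mathfrak{m}\subset\mathfrak{g}$ a real linear subspace (not necessarily a subalgebra), such that $\mathrm{Ad}_G(h)\,\mathfrak{m}\subseteq\mathfrak{m}$ for all $h\in H$. The symbols $\mathfrak{m}_0$ (for $n>3$) and $\mathfrak{m}_\beta$ (for $n=3$) denote the complementary subspaces $\mathfrak{m}$ of the reductive splittings in question. *)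

theory Defs
  imports "HOL-Analysis.Analysis" "HOL-Library.Option_ord"
begin

section \<open>Minkowski space and its Clifford algebra\<close>

text \<open>
  Vectors of Minkowski space of signature \<open>(n,1)\<close> have type \<^typ>\<open>real ^ ('n option)\<close>, where
  \<open>n = CARD('n)\<close>: the index \<^term>\<open>None\<close> is the time direction \<open>0\<close>, the indices \<open>Some i\<close> are the space
  directions \<open>1, \<dots>, n\<close>. The order on \<open>'n\<close> only serves to fix the order of the factors in
  the products \<open>e\<^sub>A\<close> below.
\<close>

definition eta_diag :: "'n option \<Rightarrow> real" where
  "eta_diag a = (if a = None then - 1 else 1)"

definition eta :: "real ^ ('n::finite) option \<Rightarrow> real ^ 'n option \<Rightarrow> real" where
  "eta v w = (\<Sum>a\<in>UNIV. eta_diag a * v $ a * w $ a)"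

text \<open>
  The Clifford algebra of \<open>\<eta>\<close>, with the convention \<open>v\<^sup>2 = \<eta>(v,v)\<close>. An element is given by its
  coordinates in the basis of the \<open>2\<^bsup>n+1\<^esup>\<close> products \<open>e\<^sub>A = e\<^sub>a\<^sub>1 \<cdots> e\<^sub>a\<^sub>k\<close>, for
  \<open>A = {a\<^sub>1 < \<dots> < a\<^sub>k}\<close>. One has \<open>e\<^sub>A e\<^sub>B = \<plusminus> e\<^sub>C\<close> where \<open>C\<close> is the symmetric difference of \<open>A\<close> and
  \<open>B\<close>; the sign, \<open>blade_sign A B\<close>, collects a factor \<open>-1\<close> for each transposition needed to
  reorder the product and a factor \<open>\<eta>(e\<^sub>a,e\<^sub>a)\<close> for each \<open>a \<in> A \<inter> B\<close>.
\<close>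

typedef 'n clifford = "UNIV :: ('n option set \<Rightarrow> real) set"
  morphisms coeff Clifford ..

setup_lifting type_definition_clifford

lemma clifford_eqI: "(\<And>A. coeff x A = coeff y A) \<Longrightarrow> x = y"
  by transfer auto

definition pair_sign :: "('n::linorder) option \<Rightarrow> 'n option \<Rightarrow> real" where
  "pair_sign a b = (if b < a then - 1 else if a = b then eta_diag a else 1)"

definition blade_sign :: "('n::linorder) option set \<Rightarrow> 'n option set \<Rightarrow> real" where
  "blade_sign A B = (\<Prod>a\<in>A. \<Prod>b\<in>B. pair_sign a b)"

lemma pair_sign_square: "pair_sign a b * pair_sign a b = 1"
  by (simp add: pair_sign_def eta_diag_def)

lemma prod_sym_diff:
  fixes f :: "'a \<Rightarrow> real"
  assumes "finite A" "finite B" and sq: "\<And>a. f a * f a = 1"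
  shows "prod f (sym_diff A B) = prod f A * prod f B"
proof -
  have A: "prod f A = prod f (A - B) * prod f (A \<inter> B)"
    using assms(1) by (subst prod.union_disjoint [symmetric]) (auto intro: prod.cong)
  have B: "prod f B = prod f (B - A) * prod f (A \<inter> B)"
    using assms(2) by (subst prod.union_disjoint [symmetric]) (auto intro: prod.cong)
  have "prod f (A \<inter> B) * prod f (A \<inter> B) = 1"
    by (simp add: prod.distrib [symmetric] sq)
  moreover have "prod f (sym_diff A B) = prod f (A - B) * prod f (B - A)"
    using assms(1,2) by (intro prod.union_disjoint) auto
  ultimately show ?thesis
    unfolding A B by (simp add: mult_ac)
qed

lemma blade_sign_square: "blade_sign A B * blade_sign A B = 1"
  by (simp add: blade_sign_def prod.distrib [symmetric] pair_sign_square)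

lemma blade_sign_sym_diff_left:
  fixes A B C :: "('n::{finite,linorder}) option set"
  shows "blade_sign (sym_diff A B) C = blade_sign A C * blade_sign B C"
  unfolding blade_sign_def
  by (rule prod_sym_diff) (simp_all add: prod.distrib [symmetric] pair_sign_square)

lemma blade_sign_sym_diff_right:
  fixes A B C :: "('n::{finite,linorder}) option set"
  shows "blade_sign A (sym_diff B C) = blade_sign A B * blade_sign A C"
  unfolding blade_sign_def
  by (simp add: prod_sym_diff pair_sign_square prod.distrib)

lemma abs_blade_sign: "\<bar>blade_sign A B\<bar> = 1"
  using blade_sign_square [of A B] by (metis abs_1 abs_mult_self_eq abs_mult abs_square_eq_1 power2_eq_square)

lemma sum_sym_diff:
  fixes f :: "('n::finite) option set \<Rightarrow> real"
  shows "(\<Sum>B\<in>UNIV. f (sym_diff A B)) = (\<Sum>B\<in>UNIV. f B)"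
  by (rule sum.reindex_bij_witness [where i = "sym_diff A" and j = "sym_diff A"]) auto

instantiation clifford :: ("{finite,linorder}") real_algebra_1
begin

lift_definition zero_clifford :: "'a clifford" is "\<lambda>_. 0" .
lift_definition one_clifford :: "'a clifford" is "\<lambda>A. if A = {} then 1 else 0" .
lift_definition plus_clifford :: "'a clifford \<Rightarrow> 'a clifford \<Rightarrow> 'a clifford" is "\<lambda>x y A. x A + y A" .
lift_definition minus_clifford :: "'a clifford \<Rightarrow> 'a clifford \<Rightarrow> 'a clifford" is "\<lambda>x y A. x A - y A" .
lift_definition uminus_clifford :: "'a clifford \<Rightarrow> 'a clifford" is "\<lambda>x A. - x A" .
lift_definition scaleR_clifford :: "real \<Rightarrow> 'a clifford \<Rightarrow> 'a clifford" is "\<lambda>c x A. c * x A" .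
lift_definition times_clifford :: "'a clifford \<Rightarrow> 'a clifford \<Rightarrow> 'a clifford" is
  "\<lambda>x y C. \<Sum>A\<in>UNIV. blade_sign A (sym_diff A C) * x A * y (sym_diff A C)" .
instance
proof
  fix x y z :: "'a clifford" and c d :: real
  show "x + y + z = x + (y + z)" by transfer (simp add: add.assoc)
  show "x + y = y + x" by transfer (simp add: add.commute)
  show "0 + x = x" by transfer simp
  show "- x + x = 0" by transfer simp
  show "x - y = x + - y" by transfer simp
  show "c *\<^sub>R (x + y) = c *\<^sub>R x + c *\<^sub>R y" by transfer (simp add: algebra_simps)
  show "(c + d) *\<^sub>R x = c *\<^sub>R x + d *\<^sub>R x" by transfer (simp add: algebra_simps)
  show "c *\<^sub>R d *\<^sub>R x = (c * d) *\<^sub>R x" by transfer (simp add: algebra_simps)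
  show "1 *\<^sub>R x = x" by transfer simp
  show "x * y * z = x * (y * z)"
  proof transfer
    fix x y z :: "'a option set \<Rightarrow> real"
    have "(\<Sum>B\<in>UNIV. blade_sign B (sym_diff B C) *
             (\<Sum>A\<in>UNIV. blade_sign A (sym_diff A B) * x A * y (sym_diff A B)) * z (sym_diff B C)) =
          (\<Sum>A\<in>UNIV. blade_sign A (sym_diff A C) * x A *
             (\<Sum>D\<in>UNIV. blade_sign D (sym_diff D (sym_diff A C)) * y D * z (sym_diff D (sym_diff A C))))"
      (is "?L = ?R") for C
    proof -
      have sgn: "blade_sign A (sym_diff A C) * blade_sign (sym_diff A B) (sym_diff B C) =
            blade_sign B (sym_diff B C) * blade_sign A (sym_diff A B)" for A B :: "'a option set"
      proof -
        have "sym_diff A C = sym_diff (sym_diff A B) (sym_diff B C)" by auto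
        then have "blade_sign A (sym_diff A C) = blade_sign A (sym_diff A B) * blade_sign A (sym_diff B C)"
          by (metis blade_sign_sym_diff_right)
        moreover have "blade_sign (sym_diff A B) (sym_diff B C) =
            blade_sign A (sym_diff B C) * blade_sign B (sym_diff B C)"
          by (rule blade_sign_sym_diff_left)
        ultimately show ?thesis
          using blade_sign_square [of A "sym_diff B C"] by (simp add: mult_ac)
      qed
      have set: "sym_diff (sym_diff A B) (sym_diff A C) = sym_diff B C" for A B :: "'a option set"
        by auto
      have "?R = (\<Sum>A\<in>UNIV. blade_sign A (sym_diff A C) * x A *
             (\<Sum>B\<in>UNIV. blade_sign (sym_diff A B) (sym_diff (sym_diff A B) (sym_diff A C)) *
                y (sym_diff A B) * z (sym_diff (sym_diff A B) (sym_diff A C))))"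
        by (subst sum_sym_diff) (rule refl)
      also have "\<dots> = (\<Sum>A\<in>UNIV. \<Sum>B\<in>UNIV.
          (blade_sign A (sym_diff A C) * blade_sign (sym_diff A B) (sym_diff B C)) *
            (x A * y (sym_diff A B) * z (sym_diff B C)))"
        unfolding set by (simp only: sum_distrib_left mult_ac)
      also have "\<dots> = (\<Sum>A\<in>UNIV. \<Sum>B\<in>UNIV.
          (blade_sign B (sym_diff B C) * blade_sign A (sym_diff A B)) *
            (x A * y (sym_diff A B) * z (sym_diff B C)))"
        unfolding sgn ..
      also have "\<dots> = (\<Sum>B\<in>UNIV. \<Sum>A\<in>UNIV.
          (blade_sign B (sym_diff B C) * blade_sign A (sym_diff A B)) *
            (x A * y (sym_diff A B) * z (sym_diff B C)))"
        by (rule sum.swap)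
      also have "\<dots> = ?L"
        by (simp only: sum_distrib_left sum_distrib_right mult_ac)
      finally show ?thesis ..
    qed
    then show "(\<lambda>C. \<Sum>B\<in>UNIV. blade_sign B (sym_diff B C) *
             (\<Sum>A\<in>UNIV. blade_sign A (sym_diff A B) * x A * y (sym_diff A B)) * z (sym_diff B C)) =
          (\<lambda>C. \<Sum>A\<in>UNIV. blade_sign A (sym_diff A C) * x A *
             (\<Sum>D\<in>UNIV. blade_sign D (sym_diff D (sym_diff A C)) * y D * z (sym_diff D (sym_diff A C))))"
      by blast
  qed
  show "(x + y) * z = x * z + y * z"
    by transfer (simp add: algebra_simps sum.distrib)
  show "x * (y + z) = x * y + x * z"
    by transfer (simp add: algebra_simps sum.distrib)
  show "c *\<^sub>R x * y = c *\<^sub>R (x * y)"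
    by transfer (simp add: sum_distrib_left mult_ac)
  show "x * c *\<^sub>R y = c *\<^sub>R (x * y)"
    by transfer (simp add: sum_distrib_left mult_ac)
  show "1 * x = x"
    by transfer (simp add: blade_sign_def if_distrib if_distribR cong: if_cong)
  show "x * 1 = x"
  proof transfer
    fix x :: "'a option set \<Rightarrow> real"
    have "sym_diff A C = {} \<longleftrightarrow> A = C" for A C :: "'a option set" by auto
    then show "(\<lambda>C. \<Sum>A\<in>UNIV. blade_sign A (sym_diff A C) * x A * (if sym_diff A C = {} then 1 else 0)) = x"
      by (simp add: blade_sign_def if_distrib cong: if_cong)
  qed
  show "(0::'a clifford) \<noteq> 1" by transfer (metis zero_neq_one)
qed

end

text \<open>The norm on the coordinates is submultiplicative; it induces the usual topology.\<close>

instantiation clifford :: ("{finite,linorder}") real_normed_algebra_1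
begin

lift_definition norm_clifford :: "'a clifford \<Rightarrow> real" is "\<lambda>x. \<Sum>A\<in>UNIV. \<bar>x A\<bar>" .

definition sgn_clifford :: "'a clifford \<Rightarrow> 'a clifford" where
  "sgn_clifford x = x /\<^sub>R norm x"
definition dist_clifford :: "'a clifford \<Rightarrow> 'a clifford \<Rightarrow> real" where
  "dist_clifford x y = norm (x - y)"
definition uniformity_clifford :: "('a clifford \<times> 'a clifford) filter" where
  "uniformity_clifford = (INF e\<in>{0 <..}. principal {(x, y). dist x y < e})"
definition open_clifford :: "'a clifford set \<Rightarrow> bool" where
  "open_clifford U \<longleftrightarrow> (\<forall>x\<in>U. \<forall>\<^sub>F (x', y) in uniformity. x' = x \<longrightarrow> y \<in> U)"

instance
proof
  fix x y :: "'a clifford" and c :: real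
  show "dist x y = norm (x - y)" by (rule dist_clifford_def)
  show "sgn x = x /\<^sub>R norm x" by (rule sgn_clifford_def)
  show "(uniformity :: ('a clifford \<times> 'a clifford) filter) = (INF e\<in>{0 <..}. principal {(x, y). dist x y < e})"
    by (rule uniformity_clifford_def)
  show "open U \<longleftrightarrow> (\<forall>x\<in>U. \<forall>\<^sub>F (x', y) in uniformity. x' = x \<longrightarrow> y \<in> U)" for U :: "'a clifford set"
    by (rule open_clifford_def)
  show "norm x = 0 \<longleftrightarrow> x = 0"
    by transfer (auto simp: sum_nonneg_eq_0_iff fun_eq_iff)
  show "norm (x + y) \<le> norm x + norm y"
    by transfer (simp add: sum.distrib [symmetric] sum_mono abs_triangle_ineq)
  show "norm (c *\<^sub>R x) = \<bar>c\<bar> * norm x"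
    by transfer (simp add: abs_mult sum_distrib_left)
  show "norm (1::'a clifford) = 1"
    by transfer (simp add: if_distrib cong: if_cong)
  show "norm (x * y) \<le> norm x * norm y"
  proof transfer
    fix x y :: "'a option set \<Rightarrow> real"
    have "(\<Sum>C\<in>UNIV. \<bar>\<Sum>A\<in>UNIV. blade_sign A (sym_diff A C) * x A * y (sym_diff A C)\<bar>)
        \<le> (\<Sum>C\<in>UNIV. \<Sum>A\<in>UNIV. \<bar>x A\<bar> * \<bar>y (sym_diff A C)\<bar>)"
      by (intro sum_mono order_trans [OF sum_abs]) (simp add: abs_mult abs_blade_sign)
    also have "\<dots> = (\<Sum>A\<in>UNIV. \<bar>x A\<bar> * (\<Sum>C\<in>UNIV. \<bar>y (sym_diff A C)\<bar>))"
      by (subst sum.swap) (simp add: sum_distrib_left)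
    also have "\<dots> = (\<Sum>A\<in>UNIV. \<bar>x A\<bar>) * (\<Sum>A\<in>UNIV. \<bar>y A\<bar>)"
      by (simp add: sum_sym_diff [of "\<lambda>A. \<bar>y A\<bar>"] sum_distrib_right)
    finally show "(\<Sum>C\<in>UNIV. \<bar>\<Sum>A\<in>UNIV. blade_sign A (sym_diff A C) * x A * y (sym_diff A C)\<bar>)
        \<le> (\<Sum>A\<in>UNIV. \<bar>x A\<bar>) * (\<Sum>A\<in>UNIV. \<bar>y A\<bar>)" .
  qed
qed

end

lift_definition blade :: "('n::{finite,linorder}) option set \<Rightarrow> 'n clifford" is
  "\<lambda>A B. if B = A then 1 else 0" .

definition gen :: "('n::{finite,linorder}) option \<Rightarrow> 'n clifford" where
  "gen a = blade {a}"

definition vec_clifford :: "real ^ ('n::{finite,linorder}) option \<Rightarrow> 'n clifford" where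
  "vec_clifford v = (\<Sum>a\<in>UNIV. v $ a *\<^sub>R gen a)"

lemma blade_mult: "blade A * blade B = blade_sign A B *\<^sub>R blade (sym_diff A B)"
proof (transfer, rule ext)
  fix A B C :: "'a option set"
  have iff: "sym_diff A C = B \<longleftrightarrow> C = sym_diff A B" by blast
  have "(\<Sum>D\<in>UNIV. blade_sign D (sym_diff D C) * (if D = A then 1 else 0) * (if sym_diff D C = B then 1 else 0)) =
        (\<Sum>D\<in>UNIV. if D = A then blade_sign A (sym_diff A C) * (if sym_diff A C = B then 1 else 0) else 0)"
    by (rule sum.cong) simp_all
  also have "\<dots> = blade_sign A (sym_diff A C) * (if sym_diff A C = B then 1 else 0)"
    by (subst sum.delta) simp_all
  also have "\<dots> = blade_sign A B * (if C = sym_diff A B then 1 else 0)"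
    unfolding iff [symmetric] by simp
  finally show "(\<Sum>D\<in>UNIV. blade_sign D (sym_diff D C) * (if D = A then 1 else 0) * (if sym_diff D C = B then 1 else 0)) =
        blade_sign A B * (if C = sym_diff A B then 1 else 0)" .
qed

lemma gen_square: "gen a * gen a = eta_diag a *\<^sub>R 1"
  unfolding gen_def blade_mult
  by (simp add: blade_sign_def pair_sign_def) (transfer, simp)

lemma gen_anticommute: "a \<noteq> b \<Longrightarrow> gen a * gen b = - (gen b * gen a)"
  unfolding gen_def blade_mult
  by (auto simp: blade_sign_def pair_sign_def insert_Diff_if insert_commute)

lemma vec_clifford_square: "vec_clifford v * vec_clifford v = eta v v *\<^sub>R 1"
proof -
  let ?S = "\<lambda>a b. (v $ a * v $ b) *\<^sub>R (gen a * gen b)"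
  have sum: "vec_clifford v * vec_clifford v = (\<Sum>a\<in>UNIV. \<Sum>b\<in>UNIV. ?S a b)"
    by (simp add: vec_clifford_def sum_product mult.commute)
  have "2 *\<^sub>R (vec_clifford v * vec_clifford v) = (\<Sum>a\<in>UNIV. \<Sum>b\<in>UNIV. ?S a b + ?S b a)"
    unfolding scaleR_2 sum.distrib using sum.swap [of ?S UNIV UNIV] by (simp add: sum)
  also have "\<dots> = (\<Sum>a\<in>UNIV. \<Sum>b\<in>UNIV. if b = a then (2 * eta_diag a * v $ a * v $ a) *\<^sub>R 1 else 0)"
  proof (intro sum.cong refl)
    fix a b :: "'a option"
    show "?S a b + ?S b a = (if b = a then (2 * eta_diag a * v $ a * v $ a) *\<^sub>R 1 else 0)"
      using gen_anticommute [of a b]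
      by (cases "a = b") (auto simp: gen_square mult.commute scaleR_left_distrib [symmetric])
  qed
  also have "\<dots> = 2 *\<^sub>R (eta v v *\<^sub>R 1)"
    by (simp add: eta_def scaleR_sum_left scaleR_sum_right mult.assoc)
  finally show ?thesis by (subst (asm) scaleR_cancel_left) simp
qed

lemma prod_list_gen:
  fixes as :: "('n::{finite,linorder}) option list"
  assumes "sorted_wrt (<) as"
  shows "prod_list (map gen as) = blade (set as)"
  using assms
proof (induction as)
  case Nil
  show ?case by simp (transfer, auto)
next
  case (Cons a as)
  have "blade_sign {a} (set as) = 1"
  proof -
    have "pair_sign a b = 1" if "b \<in> set as" for b
    proof -
      have "a < b" using Cons.prems that by simp
      then show ?thesis by (auto simp: pair_sign_def)
    qed
    then show ?thesis by (simp add: blade_sign_def)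
  qed
  moreover have "sym_diff {a} (set as) = insert a (set as)"
    using Cons.prems by auto
  ultimately show ?case
    using Cons by (simp add: gen_def [of a] blade_mult)
qed

section \<open>Spin groups\<close>

text \<open>
  The even products of unit vectors (of norm \<open>1\<close> or \<open>-1\<close>) of a subspace \<open>V\<close> of Minkowski space. For the whole
  space this is the spin group of signature \<open>(n,1)\<close>; for the span of \<open>e\<^sub>1, \<dots>, e\<^sub>n\<close> it is
  the image of \<open>Spin(n)\<close> under the inclusion of Clifford algebras.
\<close>

definition even_unit_products :: "(real ^ ('n::{finite,linorder}) option) set \<Rightarrow> 'n clifford set" where
  "even_unit_products V =
     {prod_list (map vec_clifford vs) | vs. set vs \<subseteq> V \<and> (\<forall>v\<in>set vs. \<bar>eta v v\<bar> = 1) \<and> even (length vs)}"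

definition spin_lorentz :: "('n::{finite,linorder}) clifford set" where
  "spin_lorentz = connected_component_set (even_unit_products UNIV) 1"

definition spin_euclid :: "('n::{finite,linorder}) clifford set" where
  "spin_euclid = even_unit_products {v. v $ None = 0}"

section \<open>Reductive splittings\<close>

definition smooth_curve :: "(real \<Rightarrow> 'a::real_normed_vector) \<Rightarrow> bool" where
  "smooth_curve c \<longleftrightarrow>
     (\<exists>D. D 0 = c \<and> (\<forall>k::nat. \<forall>t. (D k has_vector_derivative D (Suc k) t) (at t)))"

text \<open>
  For Lie groups given as embedded subgroups \<open>G\<close> of the group of units of a normed algebra. The Lie
  algebra is the tangent space of \<open>G\<close> at \<open>1\<close>, as a subspace of the algebra.
\<close>

definition lie_algebra :: "'a::real_normed_algebra_1 set \<Rightarrow> 'a set" where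
  "lie_algebra G =
     {X. \<exists>c. smooth_curve c \<and> range c \<subseteq> G \<and> c 0 = 1 \<and> (c has_vector_derivative X) (at 0)}"

definition unit_inv :: "'a::monoid_mult \<Rightarrow> 'a" where
  "unit_inv x = (THE y. x * y = 1 \<and> y * x = 1)"

definition Ad :: "'a::monoid_mult \<Rightarrow> 'a \<Rightarrow> 'a" where
  "Ad g x = g * x * unit_inv g"

definition reductive_splitting ::
    "'a::real_normed_algebra_1 set \<Rightarrow> 'a set \<Rightarrow> 'a set \<Rightarrow> bool" where
  "reductive_splitting G H M \<longleftrightarrow>
     subspace M \<and>
     lie_algebra G = {x + y | x y. x \<in> lie_algebra H \<and> y \<in> M} \<and>
     lie_algebra H \<inter> M = {0} \<and>
     (\<forall>h\<in>H. Ad h ` M \<subseteq> M)"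

text \<open>
  Pairwise distinct subspaces, spanned by a frame that depends smoothly on a real parameter. A smooth
  family of subspaces over the line always has such a global frame.
\<close>

definition one_parameter_family :: "(real \<Rightarrow> 'a::real_normed_vector set) \<Rightarrow> bool" where
  "one_parameter_family M \<longleftrightarrow>
     inj M \<and>
     (\<exists>(d::nat) b. (\<forall>i<d. smooth_curve (b i)) \<and>
        (\<forall>\<beta>. inj_on (\<lambda>i. b i \<beta>) {..<d} \<and> independent ((\<lambda>i. b i \<beta>) ` {..<d}) \<and>
             M \<beta> = span ((\<lambda>i. b i \<beta>) ` {..<d})))"

end

theory Submission
  imports Defs
begin

text \<open>
  Everything is read off from coordinates in the basis of blades \<open>e\<^sub>A\<close>. The Lie algebras are spaces of
  bivectors: \<open>spin(n,1)\<close> consists of the elements supported on the sets \<open>A\<close> with two elements, and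
  \<open>spin(n)\<close> of those supported on two-element sets without the time index
  (\<open>lie_algebra_spin_lorentz\<close>, \<open>lie_algebra_spin_euclid\<close>). A natural complement of the rotations
  \<open>e\<^sub>i e\<^sub>j\<close> is the span of the boosts \<open>e\<^sub>0 e\<^sub>i\<close>. It is invariant because
  elements of \<open>Spin(n)\<close> commute with \<open>e\<^sub>0\<close> and map spatial vectors to spatial vectors
  (\<open>Ad_spin_euclid_boosts\<close>).

  Any other invariant complement is the graph of an equivariant linear map \<open>\<phi>\<close> from boosts to rotations,
  that is, from the vector representation \<open>\<real>\<^sup>n\<close> to its second exterior power. The elements
  \<open>e\<^sub>j e\<^sub>k\<close> of \<open>Spin(n)\<close> act on every blade by a sign. Comparing signs shows that
  \<open>\<phi>(e\<^sub>0 e\<^sub>i)\<close> can only involve blades \<open>e\<^sub>A\<close> for which \<open>A\<close>, \<open>0\<close> and \<open>i\<close> together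
  exhaust all indices (\<open>complement_boost_coeff_zero\<close>); a two-element set cannot achieve this when
  \<open>n > 3\<close>, so \<open>\<phi> = 0\<close> and the complement is unique.

  When \<open>n = 3\<close> precisely one such \<open>A\<close> is left, and its blade is, up to sign, the product of
  \<open>e\<^sub>0 e\<^sub>i\<close> with the pseudoscalar \<open>I = e\<^sub>0 e\<^sub>1 e\<^sub>2 e\<^sub>3\<close>. Hence
  \<open>\<phi>(e\<^sub>0 e\<^sub>i) = \<beta>\<^sub>i I e\<^sub>0 e\<^sub>i\<close>, and all the \<open>\<beta>\<^sub>i\<close> agree because \<open>Spin(3)\<close> moves
  every axis to every other one and commutes with \<open>I\<close>. Conversely multiplication by \<open>I\<close> is an equivariant map from boosts
  to rotations, so each \<open>\<beta>\<close> occurs, with complement the image of the boosts under \<open>1 + \<beta> I\<close>.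
\<close>

section \<open>Coordinates of the Clifford algebra\<close>

lemmas coeff_simps = zero_clifford.rep_eq one_clifford.rep_eq plus_clifford.rep_eq
  minus_clifford.rep_eq uminus_clifford.rep_eq scaleR_clifford.rep_eq blade.rep_eq

lemma coeff_sum:
  fixes f :: "'i \<Rightarrow> ('n::{finite,linorder}) clifford"
  shows "coeff (\<Sum>i\<in>I. f i) A = (\<Sum>i\<in>I. coeff (f i) A)"
  by (induction I rule: infinite_finite_induct) (simp_all add: coeff_simps)

lemma bounded_linear_coeff:
  "bounded_linear (\<lambda>x :: ('n::{finite,linorder}) clifford. coeff x A)"
proof (rule bounded_linear_intro [where K = 1])
  fix x :: "'n clifford"
  have "\<bar>coeff x A\<bar> \<le> (\<Sum>B\<in>UNIV. \<bar>coeff x B\<bar>)"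
    by (rule member_le_sum) auto
  then show "norm (coeff x A) \<le> norm x * 1"
    by (simp add: norm_clifford.rep_eq)
qed (simp_all add: coeff_simps)

lemma clifford_expansion:
  fixes x :: "('n::{finite,linorder}) clifford"
  shows "x = (\<Sum>A\<in>UNIV. coeff x A *\<^sub>R blade A)"
  by (rule clifford_eqI) (simp add: coeff_sum coeff_simps if_distrib cong: if_cong)

lemma coeff_blade_mult:
  "coeff (blade B * x) C = blade_sign B (sym_diff B C) * coeff x (sym_diff B C)"
  by (simp add: times_clifford.rep_eq blade.rep_eq if_distrib if_distribR cong: if_cong)

lemma coeff_mult_blade:
  "coeff (x * blade B) C = blade_sign (sym_diff B C) B * coeff x (sym_diff B C)"
proof -
  have iff: "sym_diff A C = B \<longleftrightarrow> A = sym_diff B C" for A by blast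
  have eq: "sym_diff (sym_diff B C) C = B" by blast
  show ?thesis
    unfolding times_clifford.rep_eq blade.rep_eq iff
    by (simp add: if_distrib eq cong: if_cong)
qed

lemma coeff_vec_clifford: "coeff (vec_clifford v) A = (if \<exists>a. A = {a} then v $ (the_elem A) else 0)"
proof (cases "\<exists>a. A = {a}")
  case True
  then obtain a where "A = {a}" by blast
  moreover have "(\<Sum>b\<in>UNIV. v $ b * (if a = b then 1 else 0)) = v $ a"
    by (simp add: if_distrib cong: if_cong)
  ultimately show ?thesis
    by (simp add: vec_clifford_def gen_def coeff_sum coeff_simps)
next
  case False
  then show ?thesis
    by (auto simp add: vec_clifford_def gen_def coeff_sum coeff_simps intro!: sum.neutral)
qed

lemma vec_clifford_scaleR_axis:
  "vec_clifford (c *\<^sub>R axis a 1) = c *\<^sub>R gen a"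
  by (rule clifford_eqI) (auto simp: coeff_vec_clifford gen_def coeff_simps axis_def)

lemma vec_clifford_axis: "vec_clifford (axis a 1) = gen a"
  using vec_clifford_scaleR_axis [of 1 a] by simp

lemma vec_clifford_add: "vec_clifford (v + w) = vec_clifford v + vec_clifford w"
  by (simp add: vec_clifford_def scaleR_left_distrib sum.distrib)

definition clifford_on :: "('n::{finite,linorder}) option set set \<Rightarrow> 'n clifford set" where
  "clifford_on S = {x. \<forall>A. A \<notin> S \<longrightarrow> coeff x A = 0}"

lemma clifford_onI: "(\<And>A. A \<notin> S \<Longrightarrow> coeff x A = 0) \<Longrightarrow> x \<in> clifford_on S"
  and clifford_onD: "x \<in> clifford_on S \<Longrightarrow> A \<notin> S \<Longrightarrow> coeff x A = 0"
  by (auto simp: clifford_on_def)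

lemma clifford_on_mono: "x \<in> clifford_on S \<Longrightarrow> S \<subseteq> T \<Longrightarrow> x \<in> clifford_on T"
  by (auto simp: clifford_on_def)

lemma subspace_clifford_on: "subspace (clifford_on S)"
  by (auto simp: subspace_def clifford_on_def coeff_simps)

lemma blade_in_clifford_on: "A \<in> S \<Longrightarrow> blade A \<in> clifford_on S"
  by (auto simp: clifford_on_def coeff_simps)

lemma clifford_on_subset_subspace:
  assumes "subspace M" and "\<And>A. A \<in> S \<Longrightarrow> blade A \<in> M"
  shows "clifford_on S \<subseteq> M"
proof
  fix x assume x: "x \<in> clifford_on S"
  have "coeff x A *\<^sub>R blade A \<in> M" for A
    using assms x by (cases "A \<in> S") (auto simp: clifford_onD subspace_scale subspace_0)
  then have "(\<Sum>A\<in>UNIV. coeff x A *\<^sub>R blade A) \<in> M"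
    by (intro subspace_sum assms)
  then show "x \<in> M"
    using clifford_expansion [of x] by simp
qed

lemma clifford_on_mult:
  assumes x: "x \<in> clifford_on S" and y: "y \<in> clifford_on T"
    and ST: "\<And>A B. A \<in> S \<Longrightarrow> B \<in> T \<Longrightarrow> sym_diff A B \<in> U"
  shows "x * y \<in> clifford_on U"
proof (rule clifford_onI)
  fix C assume C: "C \<notin> U"
  have "coeff x A = 0 \<or> coeff y (sym_diff A C) = 0" for A
  proof -
    have "sym_diff A (sym_diff A C) = C" by blast
    then show ?thesis
      using ST [of A "sym_diff A C"] C clifford_onD [OF x] clifford_onD [OF y] by auto
  qed
  then show "coeff (x * y) C = 0"
    unfolding times_clifford.rep_eq by (intro sum.neutral) auto
qed

lemma clifford_on_disjoint_sum:
  assumes "S \<inter> T = {}"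
  shows "clifford_on (S \<union> T) = {x + y | x y. x \<in> clifford_on S \<and> y \<in> clifford_on T}"
    and "clifford_on S \<inter> clifford_on T = {0}"
proof -
  show "clifford_on (S \<union> T) = {x + y | x y. x \<in> clifford_on S \<and> y \<in> clifford_on T}"
  proof (intro set_eqI iffI)
    fix z assume z: "z \<in> clifford_on (S \<union> T)"
    let ?x = "Clifford (\<lambda>A. if A \<in> S then coeff z A else 0)"
    have "?x \<in> clifford_on S" "z - ?x \<in> clifford_on T"
      using z by (auto simp: clifford_on_def coeff_simps Clifford_inverse)
    moreover have "z = ?x + (z - ?x)" by simp
    ultimately show "z \<in> {x + y | x y. x \<in> clifford_on S \<and> y \<in> clifford_on T}" by blast
  qed (auto simp: clifford_on_def coeff_simps)
  show "clifford_on S \<inter> clifford_on T = {0}"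
    using assms by (auto simp: clifford_on_def coeff_simps intro!: clifford_eqI) blast
qed

lemma vec_clifford_range: "range vec_clifford = clifford_on {A. card A = 1}"
proof (intro set_eqI iffI)
  fix x assume x: "x \<in> clifford_on {A. card A = 1}"
  have "x = vec_clifford (\<chi> a. coeff x {a})"
  proof (rule clifford_eqI)
    fix A
    show "coeff x A = coeff (vec_clifford (\<chi> a. coeff x {a})) A"
      using clifford_onD [OF x, of A] by (auto simp: coeff_vec_clifford card_1_singleton_iff)
  qed
  then show "x \<in> range vec_clifford" by blast
qed (auto simp: clifford_on_def coeff_vec_clifford)

lemma vec_clifford_on_spatial:
  assumes "v $ None = 0"
  shows "vec_clifford v \<in> clifford_on {A. card A = 1 \<and> None \<notin> A}"
  using assms by (auto simp: clifford_on_def coeff_vec_clifford)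

text \<open>
  Moving \<open>e\<^sub>a\<close> past \<open>e\<^sub>A\<close> costs one sign for every factor of \<open>e\<^sub>A\<close> other than \<open>e\<^sub>a\<close> itself.
\<close>

lemma blade_sign_swap:
  "blade_sign A {a} * blade_sign {a} A = (- 1) ^ card (A - {a})"
proof -
  have "blade_sign A {a} * blade_sign {a} A = (\<Prod>b\<in>A. pair_sign b a * pair_sign a b)"
    by (simp add: blade_sign_def prod.distrib)
  also have "\<dots> = (\<Prod>b\<in>A. if b = a then 1 else - 1)"
    by (rule prod.cong) (auto simp: pair_sign_square, auto simp: pair_sign_def)
  also have "\<dots> = (\<Prod>b\<in>A - {a}. - 1)"
    by (cases "finite A")
      (auto intro!: prod.mono_neutral_cong_right simp del: prod_constant split: if_splits)
  finally show ?thesis by simp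
qed

lemma blade_sign_swap':
  "blade_sign A {a} = (- 1) ^ card (A - {a}) * blade_sign {a} A"
  using blade_sign_swap [of A a] blade_sign_square [of "{a}" A]
  by (metis mult.assoc mult.right_neutral)

text \<open>
  Conjugation by a generator is diagonal in the basis of blades. This is the source of all the sign
  comparisons between invariant subspaces.
\<close>

lemma coeff_gen_conjugate:
  "coeff (gen a * x * gen a) A = eta_diag a * (- 1) ^ card (A - {a}) * coeff x A"
proof -
  have eq: "sym_diff {a} (sym_diff {a} A) = A" by blast
  have s: "blade_sign {a} (sym_diff {a} A) = eta_diag a * blade_sign {a} A"
    by (subst blade_sign_sym_diff_right) (simp add: blade_sign_def pair_sign_def)
  have c: "sym_diff {a} A - {a} = A - {a}" by blast
  have "coeff (gen a * x * gen a) A =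
      blade_sign {a} A * blade_sign (sym_diff {a} A) {a} * coeff x A"
    unfolding gen_def coeff_mult_blade coeff_blade_mult eq by simp
  also have "\<dots> = eta_diag a * (- 1) ^ card (A - {a}) * (blade_sign {a} A * blade_sign {a} A) * coeff x A"
    unfolding blade_sign_swap' [of "sym_diff {a} A"] s c by (simp add: mult_ac)
  finally show ?thesis
    by (simp add: blade_sign_square)
qed

section \<open>Reversion\<close>

text \<open>
  The linear anti-automorphism that reverses the order of the factors in every product of vectors.
  Reversing \<open>k\<close> anticommuting factors takes \<open>k choose 2\<close> transpositions.
\<close>

lift_definition reversion :: "('n::{finite,linorder}) clifford \<Rightarrow> 'n clifford" is
  "\<lambda>x A. (- 1) ^ (card A choose 2) * x A" .

lemma bounded_linear_reversion: "bounded_linear reversion"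
proof (rule bounded_linear_intro [where K = 1])
  show "norm (reversion x) \<le> norm x * 1" for x :: "'a clifford"
    by transfer (simp add: abs_mult)
qed (auto intro!: clifford_eqI simp: reversion.rep_eq coeff_simps algebra_simps)

lemma reversion_1: "reversion 1 = 1"
  by (rule clifford_eqI) (simp add: reversion.rep_eq coeff_simps numeral_2_eq_2)

text \<open>
  If \<open>C\<close> arises from \<open>E\<close> by adding the index \<open>a\<close>, the reversion signs of \<open>C\<close> and \<open>E\<close> differ by
  \<open>(- 1)\<close> to the cardinality of \<open>E\<close>, because of the binomial recursion; this is exactly the sign for moving \<open>e\<^sub>a\<close>
  from one side of the blade to the other.
\<close>

lemma reversion_mult_gen: "reversion (x * gen a) = gen a * reversion x"
proof (rule clifford_eqI)
  fix C
  let ?D = "sym_diff {a} C" and ?E = "C - {a}"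
  have sgn: "(- 1) ^ (card C choose 2) * (- 1) ^ (card ?D choose 2) = ((- 1) ^ card ?E :: real)"
  proof -
    have "card (insert a ?E) = Suc (card ?E)"
      by (rule card_insert_disjoint) auto
    then have "((- 1) ^ (card ?E choose 2) * (- 1) ^ (card (insert a ?E) choose 2) :: real)
        = (- 1) ^ card ?E"
      by (simp add: numeral_2_eq_2 power_add del: insert_Diff_single)
    moreover have "C = ?E \<and> ?D = insert a ?E \<or> ?D = ?E \<and> C = insert a ?E" by blast
    ultimately show ?thesis by (metis mult.commute)
  qed
  have "?D - {a} = ?E" by blast
  then have "coeff (reversion (x * gen a)) C =
      (- 1) ^ (card C choose 2) * ((- 1) ^ card ?E * blade_sign {a} ?D) * coeff x ?D"
    using blade_sign_swap' [of ?D a]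
    by (simp only: reversion.rep_eq gen_def coeff_mult_blade mult.assoc)
  also have "\<dots> = blade_sign {a} ?D * (- 1) ^ (card ?D choose 2) * coeff x ?D"
    unfolding sgn [symmetric] by (simp add: power_mult_distrib [symmetric])
  finally show "coeff (reversion (x * gen a)) C = coeff (gen a * reversion x) C"
    by (simp add: gen_def coeff_blade_mult reversion.rep_eq)
qed

lemma reversion_mult_vec: "reversion (x * vec_clifford v) = vec_clifford v * reversion x"
proof -
  interpret bounded_linear reversion by (rule bounded_linear_reversion)
  show ?thesis
    by (simp add: vec_clifford_def sum_distrib_left sum_distrib_right sum scaleR reversion_mult_gen)
qed

lemma reversion_prod_list:
  "reversion (prod_list (map vec_clifford vs)) = prod_list (map vec_clifford (rev vs))"
  by (induction vs rule: rev_induct) (simp_all add: reversion_1 reversion_mult_vec)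

section \<open>Even products of unit vectors\<close>

lemma even_unit_products_cases:
  assumes "g \<in> even_unit_products V"
  obtains vs where "g = prod_list (map vec_clifford vs)" "set vs \<subseteq> V"
    "\<And>v. v \<in> set vs \<Longrightarrow> \<bar>eta v v\<bar> = 1" "even (length vs)"
  using assms by (auto simp: even_unit_products_def)

lemma even_unit_productsI:
  assumes "v \<in> V" "w \<in> V" "\<bar>eta v v\<bar> = 1" "\<bar>eta w w\<bar> = 1"
  shows "vec_clifford v * vec_clifford w \<in> even_unit_products V"
  unfolding even_unit_products_def
  by (rule CollectI, rule exI [of _ "[v, w]"]) (use assms in auto)

lemma even_unit_products_1: "1 \<in> even_unit_products V"
  unfolding even_unit_products_def by (rule CollectI, rule exI [of _ "[]"]) auto

lemma even_unit_products_mult: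
  assumes "g \<in> even_unit_products V" "h \<in> even_unit_products V"
  shows "g * h \<in> even_unit_products V"
proof -
  obtain vs ws where
    "g = prod_list (map vec_clifford vs)" "set vs \<subseteq> V" "\<forall>v\<in>set vs. \<bar>eta v v\<bar> = 1" "even (length vs)"
    "h = prod_list (map vec_clifford ws)" "set ws \<subseteq> V" "\<forall>w\<in>set ws. \<bar>eta w w\<bar> = 1" "even (length ws)"
    using assms unfolding even_unit_products_def by blast
  then show ?thesis
    unfolding even_unit_products_def by (intro CollectI exI [of _ "vs @ ws"]) auto
qed

lemma card_sym_diff_singleton: "even (card (sym_diff {a} A)) \<longleftrightarrow> odd (card (A :: 'a::finite set))"
proof (cases "a \<in> A")
  case True
  then have "sym_diff {a} A = A - {a}" by blast
  then show ?thesis using card_Suc_Diff1 [OF _ True] by (metis even_Suc finite)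
next
  case False
  then have "sym_diff {a} A = insert a A" by blast
  then show ?thesis using False by simp
qed

lemma even_unit_products_on_even:
  fixes g :: "('n::{finite,linorder}) clifford"
  assumes "g \<in> even_unit_products V"
  shows "g \<in> clifford_on {A. even (card A)}"
proof -
  have parity: "prod_list (map vec_clifford vs) \<in> clifford_on {A. even (card A) \<longleftrightarrow> even (length vs)}"
    for vs :: "(real ^ 'n option) list"
  proof (induction vs)
    case Nil
    show ?case by (auto simp: clifford_on_def coeff_simps)
  next
    case (Cons v vs)
    have "vec_clifford v \<in> clifford_on {A. card A = 1}"
      using vec_clifford_range by blast
    then show ?case
      unfolding list.map prod_list.Cons
      by (rule clifford_on_mult [OF _ Cons.IH])
        (auto simp: card_1_singleton_iff card_sym_diff_singleton simp del: Un_insert_left)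
  qed
  obtain vs where "g = prod_list (map vec_clifford vs)" "even (length vs)"
    using assms by (rule even_unit_products_cases) blast
  then show ?thesis using parity [of vs] by simp
qed

lemma spin_euclid_on_spatial:
  assumes "g \<in> spin_euclid"
  shows "g \<in> clifford_on {A. None \<notin> A}"
proof -
  have "prod_list (map vec_clifford vs) \<in> clifford_on {A. None \<notin> A}"
    if "\<forall>v\<in>set vs. v $ None = 0" for vs
    using that
  proof (induction vs)
    case Nil
    show ?case by (auto simp: clifford_on_def coeff_simps)
  next
    case (Cons v vs)
    then have "vec_clifford v \<in> clifford_on {A. None \<notin> A}"
      by (auto intro: clifford_on_mono [OF vec_clifford_on_spatial])
    then show ?case
      unfolding list.map prod_list.Cons
      by (rule clifford_on_mult) (use Cons in auto)
  qed
  then show ?thesis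
    using assms unfolding spin_euclid_def by (elim even_unit_products_cases) auto
qed

text \<open>
  The product telescopes: the two innermost factors are equal and multiply to a scalar.
\<close>

lemma prod_list_mult_reversion:
  fixes vs :: "(real ^ ('n::{finite,linorder}) option) list"
  shows "prod_list (map vec_clifford vs) * prod_list (map vec_clifford (rev vs)) =
    prod_list (map (\<lambda>v. eta v v) vs) *\<^sub>R 1"
proof (induction vs)
  case (Cons v vs)
  let ?p = "prod_list (map vec_clifford vs)" and ?q = "prod_list (map vec_clifford (rev vs))"
  have "prod_list (map vec_clifford (v # vs)) * prod_list (map vec_clifford (rev (v # vs))) =
      vec_clifford v * (?p * ?q) * vec_clifford v"
    by (simp add: mult.assoc)
  then show ?case
    by (simp add: Cons vec_clifford_square)
qed simp

lemma even_unit_products_mult_reversion: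
  assumes "g \<in> even_unit_products V"
  obtains r where "\<bar>r\<bar> = 1" "g * reversion g = r *\<^sub>R 1"
proof -
  obtain vs where g: "g = prod_list (map vec_clifford vs)" and vs: "\<And>v. v \<in> set vs \<Longrightarrow> \<bar>eta v v\<bar> = 1"
    using assms by (rule even_unit_products_cases) blast
  have "\<bar>prod_list (map (\<lambda>v. eta v v) vs)\<bar> = 1"
    using vs by (induction vs) (auto simp: abs_mult)
  then show ?thesis
    by (intro that) (simp_all add: g reversion_prod_list prod_list_mult_reversion)
qed

lemma vec_clifford_anticommutator:
  "vec_clifford v * vec_clifford w + vec_clifford w * vec_clifford v =
     (eta (v + w) (v + w) - eta v v - eta w w) *\<^sub>R 1"
proof -
  have "vec_clifford (v + w) * vec_clifford (v + w) =
      vec_clifford v * vec_clifford v + vec_clifford w * vec_clifford w +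
      (vec_clifford v * vec_clifford w + vec_clifford w * vec_clifford v)"
    by (simp add: vec_clifford_add algebra_simps)
  then show ?thesis
    unfolding vec_clifford_square by (simp add: algebra_simps)
qed

text \<open>
  The anticommutator of two vectors is a scalar, so \<open>v w v = r v - v\<^sup>2 w\<close> for a number \<open>r\<close>.
\<close>

lemma vec_clifford_conjugate:
  assumes "x \<in> clifford_on {A. card A = 1}"
  shows "vec_clifford v * x * vec_clifford v \<in> clifford_on {A. card A = 1}"
proof -
  obtain w where x: "x = vec_clifford w"
    using assms vec_clifford_range by blast
  obtain r where r: "vec_clifford v * vec_clifford w = r *\<^sub>R 1 - vec_clifford w * vec_clifford v"
    using vec_clifford_anticommutator [of v w] by (metis add_diff_cancel_right')
  have "vec_clifford v * x * vec_clifford v = r *\<^sub>R vec_clifford v - eta v v *\<^sub>R vec_clifford w"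
    unfolding x r by (simp add: left_diff_distrib mult.assoc vec_clifford_square)
  moreover have "vec_clifford u \<in> clifford_on {A. card A = 1}" for u :: "real ^ 'a option"
    using vec_clifford_range by blast
  ultimately show ?thesis
    by (simp add: subspace_clifford_on subspace_diff subspace_scale)
qed

text \<open>
  Together with the fact that \<open>g\<close> times its reversion is a scalar, this is the
  closed condition on \<open>g\<close> whose linearisation at \<open>1\<close> bounds the Lie algebra from above.
\<close>

lemma even_unit_products_conjugate_vector:
  assumes "g \<in> even_unit_products V" and x: "x \<in> clifford_on {A. card A = 1}"
  shows "g * x * reversion g \<in> clifford_on {A. card A = 1}"
proof -
  have "prod_list (map vec_clifford vs) * x * prod_list (map vec_clifford (rev vs))
      \<in> clifford_on {A. card A = 1}" for vs
  proof (induction vs)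
    case (Cons v vs)
    let ?y = "prod_list (map vec_clifford vs) * x * prod_list (map vec_clifford (rev vs))"
    have "vec_clifford v * ?y * vec_clifford v \<in> clifford_on {A. card A = 1}"
      by (rule vec_clifford_conjugate) (rule Cons)
    then show ?case by (simp add: mult.assoc)
  qed (use x in simp)
  then show ?thesis
    using assms(1) by (elim even_unit_products_cases) (simp add: reversion_prod_list)
qed

text \<open>
  An even number of sign changes cancels. The lemma serves twice: for \<open>J = e\<^sub>0\<close> and spatial
  vectors, and for the pseudoscalar in odd space dimension.
\<close>

lemma commute_even_unit_products:
  assumes J: "\<And>v. v \<in> V \<Longrightarrow> J * vec_clifford v = - (vec_clifford v * J)"
    and g: "g \<in> even_unit_products V"
  shows "J * g = g * J"
proof -
  have "J * prod_list (map vec_clifford vs) = (- 1) ^ length vs * prod_list (map vec_clifford vs) * J"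
    if "set vs \<subseteq> V" for vs
    using that
  proof (induction vs)
    case (Cons v vs)
    let ?s = "(- 1) ^ length vs :: 'a clifford" and ?p = "prod_list (map vec_clifford vs)"
    have "?s * x = x * ?s" for x by (cases "even (length vs)") simp_all
    have "J * (vec_clifford v * ?p) = - (vec_clifford v * (J * ?p))"
      using Cons.prems J [of v] by (simp flip: mult.assoc)
    also have "\<dots> = - (vec_clifford v * (?s * ?p * J))"
      using Cons by simp
    finally show ?case
      by (cases "even (length vs)") (simp_all add: mult.assoc)
  qed simp
  then show ?thesis
    using g by (elim even_unit_products_cases) simp
qed

section \<open>The Lie algebras of the spin groups\<close>

text \<open>
  Smoothness is the largest property of curves that is stable under differentiation, so it is enough to
  exhibit a set of curves, containing the given one, in which every member has a derivative.
\<close>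

lemma smooth_curve_coinduct:
  assumes "c \<in> S"
    and S: "\<And>f. f \<in> S \<Longrightarrow> \<exists>f'\<in>S. \<forall>t. (f has_vector_derivative f' t) (at t)"
  shows "smooth_curve c"
proof -
  from S obtain d where
    d: "\<And>f. f \<in> S \<Longrightarrow> d f \<in> S" "\<And>f t. f \<in> S \<Longrightarrow> (f has_vector_derivative d f t) (at t)"
    by metis
  have "(d ^^ k) c \<in> S" for k
    by (induction k) (use assms(1) d in auto)
  then show ?thesis
    unfolding smooth_curve_def
    by (intro exI [of _ "\<lambda>k. (d ^^ k) c"]) (use d in auto)
qed

lemma smooth_curve_derivative:
  assumes "smooth_curve c"
  obtains c' where "smooth_curve c'" "\<And>t. (c has_vector_derivative c' t) (at t)"
proof -
  obtain D where D: "D 0 = c" "\<And>k t. (D k has_vector_derivative D (Suc k) t) (at t)"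
    using assms by (auto simp: smooth_curve_def)
  have "smooth_curve (D (Suc 0))"
    unfolding smooth_curve_def by (rule exI [of _ "\<lambda>k. D (Suc k)"]) (use D in auto)
  then show thesis
    using D(2) [of 0] by (intro that [of "D (Suc 0)"]) (simp_all add: D(1))
qed

text \<open>
  A product of smooth curves is smooth since, by the Leibniz rule, these sums are stable under
  differentiation.
\<close>

inductive_set sums_of_products :: "(real \<Rightarrow> 'a::real_normed_algebra_1) set" where
  mult: "smooth_curve f \<Longrightarrow> smooth_curve g \<Longrightarrow> (\<lambda>t. f t * g t) \<in> sums_of_products"
| add: "f \<in> sums_of_products \<Longrightarrow> g \<in> sums_of_products \<Longrightarrow> (\<lambda>t. f t + g t) \<in> sums_of_products"

lemma smooth_curve_mult:
  fixes f g :: "real \<Rightarrow> 'a::real_normed_algebra_1"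
  assumes "smooth_curve f" "smooth_curve g"
  shows "smooth_curve (\<lambda>t. f t * g t)"
proof (rule smooth_curve_coinduct)
  show "(\<lambda>t. f t * g t) \<in> sums_of_products"
    using assms by (rule sums_of_products.mult)
  fix h :: "real \<Rightarrow> 'a"
  assume "h \<in> sums_of_products"
  then show "\<exists>h'\<in>sums_of_products. \<forall>t. (h has_vector_derivative h' t) (at t)"
  proof induction
    case (mult f g)
    from mult(1) obtain f' where f': "smooth_curve f'" "\<And>t. (f has_vector_derivative f' t) (at t)"
      by (rule smooth_curve_derivative) blast
    from mult(2) obtain g' where g': "smooth_curve g'" "\<And>t. (g has_vector_derivative g' t) (at t)"
      by (rule smooth_curve_derivative) blast
    have "(\<lambda>t. f t * g' t + f' t * g t) \<in> sums_of_products"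
      using mult f'(1) g'(1) by (intro sums_of_products.intros)
    then show ?case
      by (rule rev_bexI) (intro allI has_vector_derivative_mult f'(2) g'(2))
  next
    case (add f g)
    then obtain f' g' where "f' \<in> sums_of_products" "g' \<in> sums_of_products"
      "\<forall>t. (f has_vector_derivative f' t) (at t)" "\<forall>t. (g has_vector_derivative g' t) (at t)"
      by blast
    then show ?case
      by (intro bexI [of _ "\<lambda>t. f' t + g' t"])
        (auto intro: has_vector_derivative_add sums_of_products.add)
  qed
qed

lemma smooth_curve_rescale:
  assumes "smooth_curve c"
  shows "smooth_curve (\<lambda>t. c (r * t))"
proof (rule smooth_curve_coinduct)
  let ?S = "{(\<lambda>t. s *\<^sub>R f (r * t)) | s f. smooth_curve f}"
  show "(\<lambda>t. c (r * t)) \<in> ?S"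
    using assms by (intro CollectI exI [of _ 1] exI [of _ c]) simp
  fix h assume "h \<in> ?S"
  then obtain s f where h: "h = (\<lambda>t. s *\<^sub>R f (r * t))" and f: "smooth_curve f" by blast
  from f obtain f' where f': "smooth_curve f'" "\<And>t. (f has_vector_derivative f' t) (at t)"
    by (rule smooth_curve_derivative) blast
  have "((\<lambda>t. f (r * t)) has_vector_derivative r *\<^sub>R f' (r * t)) (at t)" for t
  proof -
    have "((*) r has_real_derivative r) (at t)"
      by (auto intro!: derivative_eq_intros)
    then have "((*) r has_vector_derivative r) (at t)"
      by (simp add: has_real_derivative_iff_has_vector_derivative)
    from vector_diff_chain_at [OF this f'(2)] show ?thesis
      by (simp add: o_def)
  qed
  then have "(h has_vector_derivative (s * r) *\<^sub>R f' (r * t)) (at t)" for t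
    unfolding h by (auto intro!: derivative_eq_intros)
  then show "\<exists>h'\<in>?S. \<forall>t. (h has_vector_derivative h' t) (at t)"
    using f'(1) by (intro bexI [of _ "\<lambda>t. (s * r) *\<^sub>R f' (r * t)"]) auto
qed

lemma smooth_curve_affine:
  fixes x y :: "'a::real_normed_vector"
  shows "smooth_curve (\<lambda>t. x + t *\<^sub>R y)"
proof (rule smooth_curve_coinduct)
  let ?S = "{(\<lambda>t. x + t *\<^sub>R y) | x y :: 'a. True}"
  show "(\<lambda>t. x + t *\<^sub>R y) \<in> ?S" by blast
  fix f assume "f \<in> ?S"
  then obtain u v where f: "f = (\<lambda>t. u + t *\<^sub>R v)" by blast
  have "\<forall>t. (f has_vector_derivative v + t *\<^sub>R 0) (at t)"
    unfolding f by (auto intro!: derivative_eq_intros)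
  then show "\<exists>f'\<in>?S. \<forall>t. (f has_vector_derivative f' t) (at t)"
    by (intro bexI [of _ "\<lambda>t. v + t *\<^sub>R 0"]) blast+
qed

lemma smooth_curve_circular:
  fixes x y :: "'a::real_normed_vector"
  shows "smooth_curve (\<lambda>t. cos t *\<^sub>R x + sin t *\<^sub>R y)"
proof (rule smooth_curve_coinduct)
  let ?S = "{(\<lambda>t. cos t *\<^sub>R x + sin t *\<^sub>R y) | x y :: 'a. True}"
  show "(\<lambda>t. cos t *\<^sub>R x + sin t *\<^sub>R y) \<in> ?S" by blast
  fix f assume "f \<in> ?S"
  then obtain u v where f: "f = (\<lambda>t. cos t *\<^sub>R u + sin t *\<^sub>R v)" by blast
  have "\<forall>t. (f has_vector_derivative cos t *\<^sub>R v + sin t *\<^sub>R (- u)) (at t)"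
    unfolding f by (auto intro!: derivative_eq_intros)
  then show "\<exists>f'\<in>?S. \<forall>t. (f has_vector_derivative f' t) (at t)"
    by (intro bexI [of _ "\<lambda>t. cos t *\<^sub>R v + sin t *\<^sub>R (- u)"]) blast+
qed

lemma smooth_curve_hyperbolic:
  fixes x y :: "'a::real_normed_vector"
  shows "smooth_curve (\<lambda>t. cosh t *\<^sub>R x + sinh t *\<^sub>R y)"
proof (rule smooth_curve_coinduct)
  let ?S = "{(\<lambda>t. cosh t *\<^sub>R x + sinh t *\<^sub>R y) | x y :: 'a. True}"
  show "(\<lambda>t. cosh t *\<^sub>R x + sinh t *\<^sub>R y) \<in> ?S" by blast
  fix f assume "f \<in> ?S"
  then obtain u v where f: "f = (\<lambda>t. cosh t *\<^sub>R u + sinh t *\<^sub>R v)" by blast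
  have "\<forall>t. (f has_vector_derivative cosh t *\<^sub>R v + sinh t *\<^sub>R u) (at t)"
    unfolding f by (auto intro!: derivative_eq_intros)
  then show "\<exists>f'\<in>?S. \<forall>t. (f has_vector_derivative f' t) (at t)"
    by (intro bexI [of _ "\<lambda>t. cosh t *\<^sub>R v + sinh t *\<^sub>R u"]) blast+
qed

text \<open>
  Sums of tangent vectors come from pointwise products of curves, multiples from a change of
  parameter.
\<close>

lemma subspace_lie_algebra:
  assumes "1 \<in> G" and mult: "\<And>g h. g \<in> G \<Longrightarrow> h \<in> G \<Longrightarrow> g * h \<in> G"
  shows "subspace (lie_algebra G)"
proof (rule subspaceI)
  have "smooth_curve (\<lambda>t. 1 :: 'a)"
    using smooth_curve_affine [of 1 "0 :: 'a"] by simp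
  then show "0 \<in> lie_algebra G"
    unfolding lie_algebra_def using assms(1)
    by (intro CollectI exI [of _ "\<lambda>t. 1"]) auto
next
  fix X Y assume "X \<in> lie_algebra G" "Y \<in> lie_algebra G"
  then obtain c d where
    c: "smooth_curve c" "range c \<subseteq> G" "c 0 = 1" "(c has_vector_derivative X) (at 0)" and
    d: "smooth_curve d" "range d \<subseteq> G" "d 0 = 1" "(d has_vector_derivative Y) (at 0)"
    by (auto simp: lie_algebra_def)
  show "X + Y \<in> lie_algebra G"
    unfolding lie_algebra_def
    by (intro CollectI exI [of _ "\<lambda>t. c t * d t"])
      (use c d has_vector_derivative_mult [OF c(4) d(4)] in
        \<open>auto simp: smooth_curve_mult add.commute intro!: mult\<close>)
next
  fix X and r :: real assume "X \<in> lie_algebra G"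
  then obtain c where
    c: "smooth_curve c" "range c \<subseteq> G" "c 0 = 1" "(c has_vector_derivative X) (at 0)"
    by (auto simp: lie_algebra_def)
  have "((*) r has_real_derivative r) (at 0)"
    by (auto intro!: derivative_eq_intros)
  then have "((*) r has_vector_derivative r) (at 0)"
    by (simp add: has_real_derivative_iff_has_vector_derivative)
  from vector_diff_chain_at [OF this, of c X]
  have "((\<lambda>t. c (r * t)) has_vector_derivative r *\<^sub>R X) (at 0)"
    using c(4) by (simp add: o_def)
  then show "r *\<^sub>R X \<in> lie_algebra G"
    unfolding lie_algebra_def
    by (intro CollectI exI [of _ "\<lambda>t. c (r * t)"]) (use c in \<open>auto simp: smooth_curve_rescale\<close>)
qed

text \<open>
  A smooth curve through \<open>1\<close> has connected range, so it never leaves the component of \<open>1\<close>.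
\<close>

lemma lie_algebra_connected_component:
  "lie_algebra (connected_component_set G 1) = lie_algebra G"
proof -
  have "range c \<subseteq> connected_component_set G 1"
    if c: "smooth_curve c" "range c \<subseteq> G" "c 0 = 1" for c
  proof (rule connected_component_maximal)
    obtain c' where "\<And>t. (c has_vector_derivative c' t) (at t)"
      using c(1) by (rule smooth_curve_derivative) blast
    then have "continuous_on UNIV c"
      by (meson continuous_at_imp_continuous_on has_vector_derivative_continuous)
    then show "connected (range c)"
      by (rule connected_continuous_image) simp
    show "1 \<in> range c" using c(3) by (metis rangeI)
  qed (rule c)
  then show ?thesis
    unfolding lie_algebra_def using connected_component_subset [of G 1] by blast
qed

lemma eta_axis_combination:
  assumes "a \<noteq> b"
  shows "eta (r *\<^sub>R axis a 1 + s *\<^sub>R axis b 1) (r *\<^sub>R axis a 1 + s *\<^sub>R axis b 1) =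
    eta_diag a * r\<^sup>2 + eta_diag b * s\<^sup>2"
proof -
  let ?v = "r *\<^sub>R axis a 1 + s *\<^sub>R axis b 1 :: real ^ 'a option"
  have "eta ?v ?v = (\<Sum>c\<in>UNIV. (if c = a then eta_diag a * r\<^sup>2 else 0) + (if c = b then eta_diag b * s\<^sup>2 else 0))"
    unfolding eta_def using assms
    by (intro sum.cong) (auto simp: axis_def power2_eq_square)
  then show ?thesis by (simp add: sum.distrib)
qed

text \<open>
  The one-parameter subgroups are \<open>cosh t + sinh t e\<^sub>i e\<^sub>0\<close> (boosts) and
  \<open>cos t + sin t e\<^sub>i e\<^sub>j\<close> (rotations). Each is \<open>e\<^sub>i\<close> times a unit vector in the plane of the two
  basis vectors. Putting the spatial vector first makes the curve start at \<open>1\<close> rather than at \<open>- 1\<close>.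
\<close>

lemma gen_mult_in_lie_algebra:
  assumes V: "subspace V" and a: "axis (Some i) 1 \<in> V" and b: "axis b 1 \<in> V" and ne: "b \<noteq> Some i"
  shows "gen (Some i) * gen b \<in> lie_algebra (even_unit_products V)"
proof -
  have prod: "vec_clifford (axis (Some i) 1) * vec_clifford (r *\<^sub>R axis (Some i) 1 + s *\<^sub>R axis b 1) =
      r *\<^sub>R 1 + s *\<^sub>R (gen (Some i) * gen b)" for r s
    by (simp add: vec_clifford_add vec_clifford_scaleR_axis vec_clifford_axis distrib_left
        gen_square eta_diag_def)
  have mem: "r *\<^sub>R 1 + s *\<^sub>R (gen (Some i) * gen b) \<in> even_unit_products V"
    if "r\<^sup>2 + eta_diag b * s\<^sup>2 = 1" for r s
    unfolding prod [symmetric]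
    using that eta_axis_combination [of "Some i" b r s] eta_axis_combination [of "Some i" b 1 0] ne
    by (intro even_unit_productsI a subspace_add subspace_scale V b) (auto simp: eta_diag_def)
  show ?thesis
  proof (cases b)
    case None
    let ?c = "\<lambda>t. cosh t *\<^sub>R 1 + sinh t *\<^sub>R (gen (Some i) * gen b)"
    have "(?c has_vector_derivative gen (Some i) * gen b) (at 0)"
      by (auto intro!: derivative_eq_intros)
    moreover have "?c t \<in> even_unit_products V" for t
      by (rule mem) (simp add: None eta_diag_def cosh_square_eq)
    ultimately show ?thesis
      unfolding lie_algebra_def
      by (intro CollectI exI [of _ ?c]) (auto intro: smooth_curve_hyperbolic)
  next
    case (Some j)
    let ?c = "\<lambda>t. cos t *\<^sub>R 1 + sin t *\<^sub>R (gen (Some i) * gen b)"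
    have "(?c has_vector_derivative gen (Some i) * gen b) (at 0)"
      by (auto intro!: derivative_eq_intros)
    moreover have "?c t \<in> even_unit_products V" for t
      by (rule mem) (simp add: Some eta_diag_def)
    ultimately show ?thesis
      unfolding lie_algebra_def
      by (intro CollectI exI [of _ ?c]) (auto intro: smooth_curve_circular)
  qed
qed

lemma blade_pair_in_lie_algebra:
  assumes V: "subspace V" and A: "card A = 2" "\<And>a. a \<in> A \<Longrightarrow> axis a 1 \<in> V"
  shows "blade A \<in> lie_algebra (even_unit_products V)"
proof -
  obtain i b where Aib: "A = {Some i, b}" "b \<noteq> Some i"
    using A(1) by (metis card_2_iff doubleton_eq_iff option.exhaust)
  then have "sym_diff {Some i} {b} = A" by blast
  then have "gen (Some i) * gen b = blade_sign {Some i} {b} *\<^sub>R blade A"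
    by (simp add: gen_def blade_mult)
  then have "blade A = blade_sign {Some i} {b} *\<^sub>R (gen (Some i) * gen b)"
    by (simp add: blade_sign_square)
  also have "\<dots> \<in> lie_algebra (even_unit_products V)"
    using A(2) Aib
    by (intro subspace_scale subspace_lie_algebra gen_mult_in_lie_algebra V
        even_unit_products_1 even_unit_products_mult) auto
  finally show ?thesis .
qed

lemma lie_algebra_coeff_zero:
  assumes X: "X \<in> lie_algebra G" and G: "\<And>g. g \<in> G \<Longrightarrow> coeff g A = 0"
  shows "coeff X A = 0"
proof -
  obtain c where c: "range c \<subseteq> G" "(c has_vector_derivative X) (at 0)"
    using X by (auto simp: lie_algebra_def)
  have "((\<lambda>t. coeff (c t) A) has_vector_derivative coeff X A) (at 0)"
    by (rule bounded_linear.has_vector_derivative [OF bounded_linear_coeff c(2)])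
  moreover have "(\<lambda>t. coeff (c t) A) = (\<lambda>t. 0)"
    using G c(1) by (simp add: fun_eq_iff image_subset_iff)
  ultimately show ?thesis
    by (metis has_vector_derivative_const vector_derivative_unique_at)
qed

text \<open>
  Let \<open>X\<close> be the velocity at \<open>1\<close> of a curve \<open>c\<close> in the group, and write \<open>x\<^sup>~\<close> for the reversion
  of \<open>x\<close>. Since \<open>c c\<^sup>~\<close> is \<open>1\<close> or \<open>- 1\<close>, differentiation gives \<open>X + X\<^sup>~ = 0\<close>, so \<open>X\<close> lives on blades of reversion sign
  \<open>- 1\<close>. Since \<open>c e\<^sub>a c\<^sup>~\<close> is a vector, so is \<open>X e\<^sub>a + e\<^sub>a X\<^sup>~\<close>. For even \<open>A\<close> and \<open>a \<in> A\<close> the blades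
  \<open>e\<^sub>A\<close> and \<open>e\<^sub>a\<close> anticommute, so a component of \<open>X\<close> along \<open>e\<^sub>A\<close> contributes twice itself, up to sign, on the set
  \<open>A\<close> without \<open>a\<close>, which must therefore be a singleton.
\<close>

lemma lie_algebra_even_unit_products_bivector:
  assumes "X \<in> lie_algebra (even_unit_products V)"
  shows "X \<in> clifford_on {A. card A = 2}"
proof -
  obtain c where c: "range c \<subseteq> even_unit_products V" "c 0 = 1" "(c has_vector_derivative X) (at 0)"
    using assms by (auto simp: lie_algebra_def)
  have rev: "((\<lambda>t. reversion (c t)) has_vector_derivative reversion X) (at 0)"
    by (rule bounded_linear.has_vector_derivative [OF bounded_linear_reversion c(3)])
  have deriv: "((\<lambda>t. coeff (c t * y * reversion (c t)) A) has_real_derivative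
      coeff (X * y + y * reversion X) A) (at 0)" for y A
  proof -
    have "((\<lambda>t. c t * y * reversion (c t)) has_vector_derivative
        c 0 * y * reversion X + X * y * reversion (c 0)) (at 0)"
      by (intro has_vector_derivative_mult has_vector_derivative_mult_left c(3) rev)
    then have "((\<lambda>t. c t * y * reversion (c t)) has_vector_derivative
        X * y + y * reversion X) (at 0)"
      by (simp add: c(2) reversion_1 add.commute)
    from bounded_linear.has_vector_derivative [OF bounded_linear_coeff this] show ?thesis
      by (simp add: has_real_derivative_iff_has_vector_derivative)
  qed
  have anti: "coeff X A * (1 + (- 1) ^ (card A choose 2)) = 0" for A
  proof -
    have d: "((\<lambda>t. coeff (c t * reversion (c t)) A) has_real_derivative
        coeff X A * (1 + (- 1) ^ (card A choose 2))) (at 0)"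
      using deriv [of 1 A] by (simp add: coeff_simps reversion.rep_eq algebra_simps)
    \<comment> \<open>squaring removes the unknown sign, which might depend on \<open>t\<close>\<close>
    have sq: "(coeff (c t * reversion (c t)) A)\<^sup>2 = (if A = {} then 1 else 0)" for t
    proof -
      have "c t \<in> even_unit_products V" using c(1) by blast
      then obtain r where "\<bar>r\<bar> = 1" "c t * reversion (c t) = r *\<^sub>R 1"
        by (rule even_unit_products_mult_reversion)
      then show ?thesis by (auto simp: coeff_simps abs_square_eq_1)
    qed
    have "((\<lambda>t. (coeff (c t * reversion (c t)) A)\<^sup>2) has_real_derivative
        2 * coeff (c 0 * reversion (c 0)) A * (coeff X A * (1 + (- 1) ^ (card A choose 2)))) (at 0)"
      using DERIV_power [OF d, of 2] by (simp add: mult_ac)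
    then have "2 * coeff (c 0 * reversion (c 0)) A * (coeff X A * (1 + (- 1) ^ (card A choose 2))) = 0"
      unfolding sq using DERIV_const DERIV_unique by blast
    then show ?thesis
    proof (cases "A = {}")
      case True
      then show ?thesis
        using \<open>2 * coeff (c 0 * reversion (c 0)) A * _ = 0\<close> by (simp add: c(2) reversion_1 coeff_simps)
    next
      case False
      then have "(\<lambda>t. coeff (c t * reversion (c t)) A) = (\<lambda>t. 0)"
        using sq by simp
      then show ?thesis
        using d by (metis DERIV_const DERIV_unique)
    qed
  qed
  have even: "coeff X A = 0" if "odd (card A)" for A
  proof (rule lie_algebra_coeff_zero [OF assms])
    show "coeff g A = 0" if "g \<in> even_unit_products V" for g
      using even_unit_products_on_even [OF that] \<open>odd (card A)\<close> by (simp add: clifford_onD)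
  qed
  show ?thesis
  proof (rule clifford_onI)
    fix A :: "'a option set" assume A: "A \<notin> {A. card A = 2}"
    show "coeff X A = 0"
    proof (rule ccontr)
      assume nz: "coeff X A \<noteq> 0"
      then have sgn: "(- 1) ^ (card A choose 2) = (- 1 :: real)"
        using anti [of A] by auto
      then have "A \<noteq> {}" by (auto simp: numeral_2_eq_2)
      then obtain a where a: "a \<in> A" by blast
      have ev: "even (card A)" using even nz by blast
      have c1: "odd (card (A - {a}))"
        using ev card_sym_diff_singleton [of a A] card_sym_diff_singleton [of a "A - {a}"] a
        by (simp add: insert_absorb)
      let ?B = "A - {a}"
      have eq: "sym_diff {a} ?B = A" using a by blast
      \<comment> \<open>so \<open>c e\<^sub>a c\<^sup>~\<close>, being a vector, has no component along \<open>e\<^sub>B\<close>\<close>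
      have "card ?B \<noteq> 1"
        using A a by (auto simp: card_Diff_singleton)
      moreover have "c t * gen a * reversion (c t) \<in> clifford_on {A. card A = 1}" for t
        using c(1) unfolding gen_def
        by (intro even_unit_products_conjugate_vector blade_in_clifford_on) auto
      ultimately have "(\<lambda>t. coeff (c t * gen a * reversion (c t)) ?B) = (\<lambda>t. 0)"
        by (auto dest: clifford_onD)
      then have "coeff (X * gen a + gen a * reversion X) ?B = 0"
        using deriv [of "gen a" ?B] by (metis DERIV_const DERIV_unique)
      then have "(blade_sign A {a} - blade_sign {a} A) * coeff X A = 0"
        unfolding coeff_simps gen_def coeff_mult_blade coeff_blade_mult eq reversion.rep_eq sgn
        by (simp add: algebra_simps)
      then have "blade_sign {a} A = 0"
        using nz blade_sign_swap' [of A a] c1 by simp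
      then show False
        using abs_blade_sign [of "{a}" A] by simp
    qed
  qed
qed

lemma lie_algebra_spin_lorentz: "lie_algebra spin_lorentz = clifford_on {A. card A = 2}"
proof
  show "lie_algebra spin_lorentz \<subseteq> clifford_on {A. card A = 2}"
    unfolding spin_lorentz_def lie_algebra_connected_component
    using lie_algebra_even_unit_products_bivector by blast
  show "clifford_on {A. card A = 2} \<subseteq> lie_algebra spin_lorentz"
    unfolding spin_lorentz_def lie_algebra_connected_component
    by (intro clifford_on_subset_subspace subspace_lie_algebra even_unit_products_1
        even_unit_products_mult blade_pair_in_lie_algebra) auto
qed

lemma lie_algebra_spin_euclid:
  "lie_algebra (spin_euclid :: ('n::{finite,linorder}) clifford set) =
    clifford_on {A. card A = 2 \<and> None \<notin> A}"
proof
  show "lie_algebra (spin_euclid :: 'n clifford set) \<subseteq> clifford_on {A. card A = 2 \<and> None \<notin> A}"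
  proof
    fix X :: "'n clifford" assume X: "X \<in> lie_algebra spin_euclid"
    have "X \<in> clifford_on {A. card A = 2}"
      using X lie_algebra_even_unit_products_bivector unfolding spin_euclid_def by blast
    moreover have "coeff X A = 0" if "None \<in> A" for A
    proof (rule lie_algebra_coeff_zero [OF X])
      show "coeff g A = 0" if "g \<in> spin_euclid" for g
        using spin_euclid_on_spatial [OF that] \<open>None \<in> A\<close> by (simp add: clifford_onD)
    qed
    ultimately show "X \<in> clifford_on {A. card A = 2 \<and> None \<notin> A}"
      by (auto simp: clifford_on_def)
  qed
  have "subspace {v :: real ^ 'n option. v $ None = 0}"
    by (auto simp: subspace_def)
  then show "clifford_on {A. card A = 2 \<and> None \<notin> A} \<subseteq> lie_algebra (spin_euclid :: 'n clifford set)"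
    unfolding spin_euclid_def
    by (intro clifford_on_subset_subspace subspace_lie_algebra even_unit_products_1
        even_unit_products_mult blade_pair_in_lie_algebra) (auto simp: axis_def)
qed

section \<open>The adjoint action of the spatial spin group\<close>

text \<open>
  Spatial unit vectors have square \<open>1\<close>, never \<open>- 1\<close>.
\<close>

lemma spin_euclid_reversion:
  assumes "g \<in> spin_euclid"
  shows "g * reversion g = 1" "reversion g * g = 1"
proof -
  obtain vs where g: "g = prod_list (map vec_clifford vs)" and sp: "set vs \<subseteq> {v. v $ None = 0}"
    and vs: "\<And>v. v \<in> set vs \<Longrightarrow> \<bar>eta v v\<bar> = 1"
    using assms unfolding spin_euclid_def by (rule even_unit_products_cases) blast
  have "eta v v = 1" if v: "v \<in> set vs" for v
  proof -
    have "v $ None = 0" using v sp by blast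
    then have "eta_diag a * v $ a * v $ a \<ge> 0" for a
      by (cases a) (auto simp: eta_diag_def)
    then have "eta v v \<ge> 0"
      unfolding eta_def by (intro sum_nonneg)
    then show ?thesis using vs [OF v] by simp
  qed
  then have eta: "map (\<lambda>v. eta v v) vs = map (\<lambda>v. 1) vs"
    by simp
  have "prod_list (map (\<lambda>v. 1 :: real) ws) = 1" for ws :: "(real ^ 'a option) list"
    by (induction ws) simp_all
  then have "prod_list (map (\<lambda>v. eta v v) vs) = 1" "prod_list (map (\<lambda>v. eta v v) (rev vs)) = 1"
    unfolding rev_map [symmetric] eta by (simp_all add: rev_map)
  then show "g * reversion g = 1" "reversion g * g = 1"
    using prod_list_mult_reversion [of vs] prod_list_mult_reversion [of "rev vs"]
    by (simp_all add: g reversion_prod_list)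
qed

lemma Ad_spin_euclid:
  assumes "g \<in> spin_euclid"
  shows "Ad g x = g * x * reversion g"
proof -
  have "unit_inv g = reversion g"
    unfolding unit_inv_def
  proof (rule the_equality)
    show "g * reversion g = 1 \<and> reversion g * g = 1"
      using spin_euclid_reversion [OF assms] by simp
    show "y = reversion g" if "g * y = 1 \<and> y * g = 1" for y
      using that spin_euclid_reversion [OF assms] by (metis mult.assoc mult_1_left mult_1_right)
  qed
  then show ?thesis by (simp add: Ad_def)
qed

lemma vec_clifford_anticommuteI:
  assumes "\<And>a. v $ a \<noteq> 0 \<Longrightarrow> J * gen a = - (gen a * J)"
  shows "J * vec_clifford v = - (vec_clifford v * J)"
  unfolding vec_clifford_def sum_distrib_left sum_distrib_right sum_negf [symmetric]
proof (intro sum.cong refl)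
  show "J * v $ a *\<^sub>R gen a = - (v $ a *\<^sub>R gen a * J)" for a
    by (cases "v $ a = 0") (simp_all add: assms)
qed

lemma spin_euclid_commute_gen_None:
  assumes "g \<in> spin_euclid"
  shows "gen None * g = g * gen None"
  using assms unfolding spin_euclid_def
  by (rule commute_even_unit_products [rotated])
    (auto intro!: vec_clifford_anticommuteI gen_anticommute)

lemma gen_pair_in_spin_euclid: "gen (Some j) * gen (Some k) \<in> spin_euclid"
proof -
  have "eta (axis (Some i) 1) (axis (Some i) 1) = 1" for i :: 'a
    using eta_axis_combination [of "Some i" None 1 0] by (simp add: eta_diag_def)
  then have "vec_clifford (axis (Some j) 1) * vec_clifford (axis (Some k) 1) \<in> spin_euclid"
    unfolding spin_euclid_def by (intro even_unit_productsI) (auto simp: axis_def)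
  then show ?thesis by (simp add: vec_clifford_axis)
qed

lemma coeff_Ad_gen_pair:
  "coeff (Ad (gen (Some j) * gen (Some k)) x) A =
     (- 1) ^ (card (A - {Some j}) + card (A - {Some k})) * coeff x A"
proof -
  have "reversion (gen (Some j) * gen (Some k)) = gen (Some k) * gen (Some j)"
    using reversion_mult_gen [of 1 "Some j"] by (simp add: reversion_mult_gen reversion_1)
  then have "Ad (gen (Some j) * gen (Some k)) x =
      gen (Some j) * (gen (Some k) * x * gen (Some k)) * gen (Some j)"
    by (simp add: Ad_spin_euclid gen_pair_in_spin_euclid mult.assoc)
  then show ?thesis
    by (simp add: coeff_gen_conjugate eta_diag_def power_add)
qed

abbreviation rotations :: "('n::{finite,linorder}) clifford set" where
  "rotations \<equiv> clifford_on {A. card A = 2 \<and> None \<notin> A}"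

abbreviation boosts :: "('n::{finite,linorder}) clifford set" where
  "boosts \<equiv> clifford_on {A. card A = 2 \<and> None \<in> A}"

text \<open>
  A boost is \<open>e\<^sub>0 w\<close> with a spatial vector \<open>w\<close>. As \<open>g\<close> commutes with \<open>e\<^sub>0\<close>, the
  adjoint action only affects \<open>w\<close>, and it keeps \<open>w\<close> a spatial vector.
\<close>

lemma Ad_spin_euclid_boosts:
  assumes g: "g \<in> spin_euclid" and x: "x \<in> boosts"
  shows "Ad g x \<in> boosts"
proof -
  define w where "w = gen None * x"
  have gN: "gen None \<in> clifford_on {{None}}"
    unfolding gen_def by (rule blade_in_clifford_on) simp
  have w: "w \<in> clifford_on {A. card A = 1 \<and> None \<notin> A}"
    unfolding w_def by (rule clifford_on_mult [OF gN x]) (auto simp: card_2_iff)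
  have spatial: "y * z \<in> clifford_on {A. None \<notin> A}"
    if "y \<in> clifford_on {A. None \<notin> A}" "z \<in> clifford_on {A. None \<notin> A}" for y z :: "'a clifford"
    by (rule clifford_on_mult [OF that]) auto
  have "g \<in> clifford_on {A. None \<notin> A}"
    by (rule spin_euclid_on_spatial [OF g])
  moreover from this have "reversion g \<in> clifford_on {A. None \<notin> A}"
    by (auto simp: clifford_on_def reversion.rep_eq)
  moreover have "w \<in> clifford_on {A. None \<notin> A}"
    using w by (rule clifford_on_mono) blast
  ultimately have "g * w * reversion g \<in> clifford_on {A. None \<notin> A}"
    by (intro spatial)
  moreover have "g * w * reversion g \<in> clifford_on {A. card A = 1}"
  proof (rule even_unit_products_conjugate_vector)
    show "g \<in> even_unit_products {v. v $ None = 0}"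
      using g by (simp add: spin_euclid_def)
    show "w \<in> clifford_on {A. card A = 1}"
      using w by (rule clifford_on_mono) blast
  qed
  ultimately have gw: "g * w * reversion g \<in> clifford_on {A. card A = 1 \<and> None \<notin> A}"
    by (auto simp: clifford_on_def)
  have "x = - (gen None * w)"
    by (simp add: w_def gen_square eta_diag_def flip: mult.assoc)
  then have "Ad g x = - (gen None * (g * w * reversion g))"
    using spin_euclid_commute_gen_None [OF g]
    by (simp add: Ad_spin_euclid [OF g] flip: mult.assoc)
  moreover have "gen None * (g * w * reversion g) \<in> boosts"
    by (rule clifford_on_mult [OF gN gw]) (auto simp: card_1_singleton_iff)
  ultimately show ?thesis
    by (simp add: subspace_clifford_on subspace_neg)
qed

definition boost :: "'n \<Rightarrow> ('n::{finite,linorder}) clifford" where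
  "boost i = gen None * gen (Some i)"

lemma boost_eq_blade: "boost i = blade {None, Some i}"
proof -
  have "sym_diff {None} {Some i} = {None, Some i}" by blast
  then show ?thesis
    by (simp add: boost_def gen_def blade_mult blade_sign_def pair_sign_def)
qed

lemma boosts_subset_subspace:
  assumes "subspace M" and "\<And>i. boost i \<in> M"
  shows "boosts \<subseteq> M"
proof (rule clifford_on_subset_subspace [OF assms(1)])
  fix A :: "'a option set" assume "A \<in> {A. card A = 2 \<and> None \<in> A}"
  then have None: "None \<in> A" and "card (A - {None}) = 1" by simp_all
  from this(2) obtain b where b: "A - {None} = {b}"
    by (rule card_1_singletonE)
  then have "b \<noteq> None" by auto
  moreover have "A = {None, b}"
    using insert_Diff [OF None] b by simp
  ultimately have "b \<noteq> None" "A = {None, b}" by simp_all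
  then show "blade A \<in> M"
    using assms(2) by (auto simp: boost_eq_blade)
qed

lemma boost_in_boosts: "boost i \<in> boosts"
  by (simp add: boost_eq_blade blade_in_clifford_on)

text \<open>
  The element \<open>h = w e\<^sub>i\<close>, with \<open>w\<close> the unit vector that bisects \<open>e\<^sub>i\<close> and \<open>e\<^sub>j\<close>, works: conjugation by \<open>e\<^sub>i\<close>
  fixes \<open>e\<^sub>i\<close>, and conjugation by \<open>w\<close> maps \<open>e\<^sub>i\<close> to \<open>e\<^sub>j\<close>.
\<close>

lemma Ad_rotate_boost:
  assumes "i \<noteq> j"
  obtains h where "h \<in> spin_euclid" "Ad h (boost i) = boost j"
proof
  define c :: real where "c = 1 / sqrt 2"
  have c: "c * c = 1 / 2" by (simp add: c_def)
  let ?ei = "gen (Some i)" and ?ej = "gen (Some j)"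
  define w where "w = c *\<^sub>R axis (Some i) 1 + c *\<^sub>R axis (Some j) (1 :: real)"
  have vw: "vec_clifford w = c *\<^sub>R (?ei + ?ej)"
    by (simp add: w_def vec_clifford_add vec_clifford_scaleR_axis scaleR_add_right)
  let ?h = "vec_clifford w * ?ei"
  have "eta w w = 1"
    unfolding w_def using assms eta_axis_combination [of "Some i" "Some j" c c]
    by (simp add: eta_diag_def power2_eq_square c)
  moreover have "eta (axis (Some i) 1) (axis (Some i) 1) = 1"
    using eta_axis_combination [of "Some i" None 1 0] by (simp add: eta_diag_def)
  ultimately have "vec_clifford w * vec_clifford (axis (Some i) 1) \<in> spin_euclid"
    unfolding spin_euclid_def by (intro even_unit_productsI) (auto simp: axis_def w_def)
  then show h: "?h \<in> spin_euclid"
    by (simp add: vec_clifford_axis)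
  have sq: "?ei * ?ei = 1" "?ej * ?ej = 1"
    by (simp_all add: gen_square eta_diag_def)
  have sq': "?ei * (?ei * x) = x" "?ej * (?ej * x) = x" for x
    by (simp_all add: sq flip: mult.assoc)
  have anti: "?ej * ?ei = - (?ei * ?ej)"
    using assms by (intro gen_anticommute) simp
  have anti': "?ej * (?ei * x) = - (?ei * (?ej * x))" for x
    by (simp add: anti flip: mult.assoc)
  have "reversion ?h = ?ei * vec_clifford w"
    using reversion_mult_vec [of 1 w] by (simp add: reversion_mult_gen reversion_1)
  then have "Ad ?h (boost i) = ?h * gen None * ?ei * (?ei * vec_clifford w)"
    by (simp add: Ad_spin_euclid [OF h] boost_def mult.assoc)
  also have "\<dots> = gen None * (vec_clifford w * ?ei * vec_clifford w)"
    unfolding spin_euclid_commute_gen_None [OF h, symmetric] by (simp add: mult.assoc sq')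
  also have "vec_clifford w * ?ei * vec_clifford w = (c * c) *\<^sub>R (?ej + ?ej)"
    by (simp add: vw distrib_left distrib_right left_diff_distrib mult.assoc sq sq' anti anti'
        scaleR_add_right scaleR_diff_right)
  also have "\<dots> = ?ej"
    by (simp add: c flip: scaleR_2)
  finally show "Ad ?h (boost i) = boost j"
    by (simp add: boost_def)
qed

section \<open>The pseudoscalar\<close>

abbreviation pseudoscalar :: "('n::{finite,linorder}) clifford" where
  "pseudoscalar \<equiv> blade UNIV"

lemma pseudoscalar_square:
  obtains s where "s \<noteq> 0" "pseudoscalar * (pseudoscalar * x) = s *\<^sub>R x"
proof
  have "blade {} = (1 :: 'a clifford)"
    by (rule clifford_eqI) (simp add: coeff_simps)
  then show "pseudoscalar * (pseudoscalar * x) = blade_sign UNIV (UNIV :: 'a option set) *\<^sub>R x"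
    by (simp add: blade_mult flip: mult.assoc)
  show "blade_sign UNIV (UNIV :: 'a option set) \<noteq> 0"
    using abs_blade_sign [of "UNIV :: 'a option set" UNIV] by force
qed

text \<open>
  For odd \<open>n\<close> the pseudoscalar has an even number \<open>n + 1\<close> of factors, so it anticommutes with every
  vector.
\<close>

lemma pseudoscalar_commute:
  fixes g :: "('n::{finite,linorder}) clifford"
  assumes "odd CARD('n)" and "g \<in> even_unit_products V"
  shows "pseudoscalar * g = g * pseudoscalar"
proof (rule commute_even_unit_products [OF vec_clifford_anticommuteI assms(2)])
  fix a :: "'n option"
  have "card (UNIV - {a}) = CARD('n)"
    by (simp add: card_Diff_singleton card_option)
  then have "blade_sign UNIV {a} = - blade_sign {a} UNIV"
    using assms(1) blade_sign_swap' [of UNIV a] by simp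
  then show "pseudoscalar * gen a = - (gen a * pseudoscalar)"
    by (simp add: gen_def blade_mult)
qed

text \<open>
  In dimension four the complement of a two-element set again has two elements: multiplication by the
  pseudoscalar is Hodge duality, and it exchanges boosts and rotations.
\<close>

lemma pseudoscalar_boosts:
  fixes x :: "('n::{finite,linorder}) clifford"
  assumes "CARD('n) = 3" and "x \<in> boosts"
  shows "pseudoscalar * x \<in> rotations"
proof (rule clifford_on_mult [OF blade_in_clifford_on [OF singletonI] assms(2)])
  fix A B :: "'n option set"
  assume "A \<in> {UNIV}" "B \<in> {A. card A = 2 \<and> None \<in> A}"
  then show "sym_diff A B \<in> {A. card A = 2 \<and> None \<notin> A}"
    using assms(1) by (simp add: card_Diff_subset card_option)
qed

section \<open>Invariant complements\<close>

lemma reductive_splitting_spin_iff: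
  "reductive_splitting spin_lorentz spin_euclid M \<longleftrightarrow>
     subspace M \<and>
     clifford_on {A. card A = 2} = {x + y | x y. x \<in> rotations \<and> y \<in> M} \<and>
     rotations \<inter> M = {0} \<and> (\<forall>h\<in>spin_euclid. \<forall>x\<in>M. Ad h x \<in> M)"
  unfolding reductive_splitting_def lie_algebra_spin_lorentz lie_algebra_spin_euclid
  by (simp add: image_subset_iff)

lemma bivectors_split:
  "clifford_on {A :: ('n::{finite,linorder}) option set. card A = 2} =
     {x + y | x y. x \<in> rotations \<and> y \<in> boosts}"
  "rotations \<inter> boosts = {0 :: 'n clifford}"
proof -
  have "{A :: 'n option set. card A = 2} = {A. card A = 2 \<and> None \<notin> A} \<union> {A. card A = 2 \<and> None \<in> A}"
    by blast
  moreover have disj: "{A :: 'n option set. card A = 2 \<and> None \<notin> A} \<inter> {A. card A = 2 \<and> None \<in> A} = {}"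
    by blast
  ultimately show "clifford_on {A :: 'n option set. card A = 2} = {x + y | x y. x \<in> rotations \<and> y \<in> boosts}"
    using clifford_on_disjoint_sum(1) [OF disj] by (simp only:)
  show "rotations \<inter> boosts = {0 :: 'n clifford}"
    using disj by (rule clifford_on_disjoint_sum)
qed

text \<open>
  This is \<open>m\<^sub>\<beta>\<close>; the value \<open>\<beta> = 0\<close> gives the span of the boosts, which is \<open>m\<^sub>0\<close>.
\<close>

definition immirzi_complement :: "real \<Rightarrow> ('n::{finite,linorder}) clifford set" where
  "immirzi_complement \<beta> = (\<lambda>x. x + \<beta> *\<^sub>R (pseudoscalar * x)) ` boosts"

lemma linear_immirzi: "linear (\<lambda>x :: ('n::{finite,linorder}) clifford. x + \<beta> *\<^sub>R (pseudoscalar * x))"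
  by (rule linearI) (simp_all add: algebra_simps)

text \<open>
  Modulo rotations, \<open>1 + \<beta> I\<close> is the identity on boosts. This gives both its injectivity and
  the directness of the sum. The case \<open>\<beta> = 0\<close> is kept in all dimensions, so that the complement for
  \<open>n > 3\<close> is covered by the same lemmas.
\<close>

lemma immirzi_modulo_rotations:
  fixes x :: "('n::{finite,linorder}) clifford"
  assumes x: "x \<in> boosts" and n: "\<beta> = 0 \<or> CARD('n) = 3"
  shows "\<beta> *\<^sub>R (pseudoscalar * x) \<in> rotations"
    and "x + \<beta> *\<^sub>R (pseudoscalar * x) \<in> rotations \<longleftrightarrow> x = 0"
proof -
  show rot: "\<beta> *\<^sub>R (pseudoscalar * x) \<in> rotations"
  proof (cases "\<beta> = 0")
    case False
    then show ?thesis
      using n pseudoscalar_boosts [OF _ x] by (intro subspace_scale subspace_clifford_on) simp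
  qed (simp add: subspace_0 subspace_clifford_on)
  then have "x + \<beta> *\<^sub>R (pseudoscalar * x) \<in> rotations \<longleftrightarrow> x \<in> rotations"
    using subspace_add [OF subspace_clifford_on _ rot] subspace_diff [OF subspace_clifford_on _ rot]
    by fastforce
  then show "x + \<beta> *\<^sub>R (pseudoscalar * x) \<in> rotations \<longleftrightarrow> x = 0"
    using bivectors_split(2) x by blast
qed

lemma immirzi_complement_reductive:
  assumes n: "\<beta> = 0 \<or> CARD('n::{finite,linorder}) = 3"
  shows "reductive_splitting spin_lorentz spin_euclid (immirzi_complement \<beta> :: 'n clifford set)"
  unfolding reductive_splitting_spin_iff
proof (intro conjI ballI)
  let ?T = "\<lambda>x :: 'n clifford. x + \<beta> *\<^sub>R (pseudoscalar * x)"
  show "subspace (immirzi_complement \<beta> :: 'n clifford set)"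
    unfolding immirzi_complement_def
    by (intro linear_subspace_image linear_immirzi subspace_clifford_on)
  show "clifford_on {A. card A = 2} = {x + y | x y. x \<in> rotations \<and> y \<in> (immirzi_complement \<beta> :: 'n clifford set)}"
  proof (intro set_eqI iffI)
    fix z :: "'n clifford" assume "z \<in> clifford_on {A. card A = 2}"
    then obtain x y where z: "z = x + y" and x: "x \<in> rotations" and y: "y \<in> boosts"
      unfolding bivectors_split by blast
    have "z = (x - \<beta> *\<^sub>R (pseudoscalar * y)) + ?T y" by (simp add: z)
    moreover have "x - \<beta> *\<^sub>R (pseudoscalar * y) \<in> rotations"
      by (intro subspace_diff subspace_clifford_on x immirzi_modulo_rotations y n)
    ultimately show "z \<in> {x + y | x y. x \<in> rotations \<and> y \<in> immirzi_complement \<beta>}"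
      using y unfolding immirzi_complement_def by blast
  next
    fix z :: "'n clifford" assume "z \<in> {x + y | x y. x \<in> rotations \<and> y \<in> immirzi_complement \<beta>}"
    then obtain x y where z: "z = x + ?T y" and x: "x \<in> rotations" and y: "y \<in> boosts"
      unfolding immirzi_complement_def by blast
    have "z = (x + \<beta> *\<^sub>R (pseudoscalar * y)) + y" by (simp add: z)
    moreover have "x + \<beta> *\<^sub>R (pseudoscalar * y) \<in> rotations"
      by (intro subspace_add subspace_clifford_on x immirzi_modulo_rotations y n)
    ultimately show "z \<in> clifford_on {A. card A = 2}"
      using y unfolding bivectors_split by blast
  qed
  show "rotations \<inter> (immirzi_complement \<beta> :: 'n clifford set) = {0}"
  proof
    show "rotations \<inter> (immirzi_complement \<beta> :: 'n clifford set) \<subseteq> {0}"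
      using immirzi_modulo_rotations(2) [OF _ n] by (auto simp: immirzi_complement_def)
    show "{0} \<subseteq> rotations \<inter> (immirzi_complement \<beta> :: 'n clifford set)"
      using \<open>subspace (immirzi_complement \<beta>)\<close> by (simp add: subspace_0 subspace_clifford_on)
  qed
  fix h x :: "'n clifford" assume h: "h \<in> spin_euclid" and "x \<in> immirzi_complement \<beta>"
  then obtain y where y: "y \<in> boosts" and x: "x = ?T y"
    by (auto simp: immirzi_complement_def)
  have "\<beta> *\<^sub>R (h * (pseudoscalar * y) * reversion h) = \<beta> *\<^sub>R (pseudoscalar * (h * y * reversion h))"
  proof (cases "\<beta> = 0")
    case False
    then have "pseudoscalar * h = h * pseudoscalar"
      using n h unfolding spin_euclid_def by (intro pseudoscalar_commute) auto
    then show ?thesis by (simp flip: mult.assoc)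
  qed simp
  then have "Ad h x = ?T (Ad h y)"
    by (simp add: Ad_spin_euclid [OF h] x distrib_left distrib_right)
  then show "Ad h x \<in> immirzi_complement \<beta>"
    unfolding immirzi_complement_def using Ad_spin_euclid_boosts [OF h y] by blast
qed

text \<open>
  Complements of the same subspace are incomparable, so one inclusion suffices in
  both uniqueness arguments.
\<close>

lemma reductive_splitting_subset_eq:
  fixes M N :: "('n::{finite,linorder}) clifford set"
  assumes M: "reductive_splitting spin_lorentz spin_euclid M"
    and N: "reductive_splitting spin_lorentz spin_euclid N" and "N \<subseteq> M"
  shows "M = N"
proof
  show "M \<subseteq> N"
  proof
    fix z assume z: "z \<in> M"
    have "0 \<in> (rotations :: 'n clifford set)" by (simp add: subspace_0 subspace_clifford_on)
    then have "z \<in> clifford_on {A. card A = 2}"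
      using M z unfolding reductive_splitting_spin_iff by force
    then obtain x y where xy: "z = x + y" "x \<in> rotations" "y \<in> N"
      using N unfolding reductive_splitting_spin_iff by blast
    have "subspace M"
      using M by (simp add: reductive_splitting_spin_iff)
    then have "z - y \<in> M"
      using z xy(3) \<open>N \<subseteq> M\<close> by (intro subspace_diff) auto
    then have "x \<in> M" by (simp add: xy(1))
    then have "x = 0"
      using M xy unfolding reductive_splitting_spin_iff by blast
    then show "z \<in> N" using xy by simp
  qed
qed fact

text \<open>
  Only two-element sets \<open>A\<close> of spatial indices matter. Choose indices \<open>j \<in> A\<close> and \<open>k \<notin> A\<close>, both spatial and different from
  \<open>i\<close>. The element
  \<open>h = e\<^sub>j e\<^sub>k\<close> of \<open>Spin(n)\<close> fixes the boost \<open>e\<^sub>0 e\<^sub>i\<close>, so it changes \<open>e\<^sub>0 e\<^sub>i + x\<close> by a rotation in the complement, hence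
  not at all. But \<open>h\<close> reverses the sign of \<open>e\<^sub>A\<close>.
\<close>

lemma complement_boost_coeff_zero:
  fixes x :: "('n::{finite,linorder}) clifford"
  assumes M: "reductive_splitting spin_lorentz spin_euclid M"
    and x: "x \<in> rotations" and xM: "boost i + x \<in> M"
    and A: "insert None (insert (Some i) A) \<noteq> UNIV"
  shows "coeff x A = 0"
proof (cases "card A = 2 \<and> None \<notin> A")
  case True
  then obtain j where j: "Some j \<in> A" "j \<noteq> i"
    by (metis (no_types, lifting) card_2_iff insertCI option.exhaust)
  from A obtain k where k: "Some k \<notin> A" "k \<noteq> i"
    by (metis UNIV_eq_I insertCI option.exhaust)
  let ?h = "gen (Some j) * gen (Some k)"
  have "Ad ?h (boost i) = boost i"
  proof (rule clifford_eqI)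
    show "coeff (Ad ?h (boost i)) B = coeff (boost i) B" for B
      using j k by (auto simp: coeff_Ad_gen_pair boost_eq_blade coeff_simps)
  qed
  moreover have "Ad ?h (boost i + x) = Ad ?h (boost i) + Ad ?h x"
    by (simp add: Ad_def algebra_simps)
  moreover have "Ad ?h (boost i + x) \<in> M"
    using M xM gen_pair_in_spin_euclid unfolding reductive_splitting_spin_iff by blast
  ultimately have "(boost i + Ad ?h x) - (boost i + x) \<in> M"
    using M xM unfolding reductive_splitting_spin_iff by (intro subspace_diff) simp_all
  then have "Ad ?h x - x \<in> M" by simp
  moreover have "Ad ?h x - x \<in> rotations"
    using x by (auto simp: clifford_on_def coeff_simps coeff_Ad_gen_pair)
  ultimately have "Ad ?h x - x = 0"
    using M unfolding reductive_splitting_spin_iff by blast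
  then have "coeff (Ad ?h x) A = coeff x A" by simp
  moreover have "card (A - {Some j}) = 1" "card (A - {Some k}) = 2"
    using True j k by auto
  ultimately show ?thesis
    unfolding coeff_Ad_gen_pair by simp
qed (use x in \<open>auto simp: clifford_on_def\<close>)

lemma obtain_complement_boost:
  assumes "reductive_splitting spin_lorentz spin_euclid M"
  obtains x where "x \<in> rotations" "boost i + x \<in> M"
proof -
  have "boost i \<in> clifford_on {A. card A = 2}"
    using boost_in_boosts by (rule clifford_on_mono) blast
  then obtain x y where "boost i = x + y" "x \<in> rotations" "y \<in> M"
    using assms unfolding reductive_splitting_spin_iff by blast
  then have "- x \<in> rotations" "boost i + (- x) \<in> M"
    by (simp_all add: subspace_neg subspace_clifford_on)
  then show thesis by (rule that)
qed

lemma unique_reductive_splitting: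
  fixes M :: "('n::{finite,linorder}) clifford set"
  assumes n: "CARD('n) > 3" and M: "reductive_splitting spin_lorentz spin_euclid M"
  shows "M = immirzi_complement 0"
proof (rule reductive_splitting_subset_eq [OF M])
  show "reductive_splitting spin_lorentz spin_euclid (immirzi_complement 0 :: 'n clifford set)"
    by (rule immirzi_complement_reductive) simp
  have "boost i \<in> M" for i
  proof -
    obtain x where x: "x \<in> rotations" "boost i + x \<in> M"
      using M by (rule obtain_complement_boost)
    have "coeff x A = 0" for A
    proof (cases "card A = 2")
      case True
      have "card (insert None (insert (Some i) A)) \<le> 4"
        using True by (simp add: card_insert_if)
      moreover have "card (UNIV :: 'n option set) > 4"
        using n by (simp add: card_option)
      ultimately have "insert None (insert (Some i) A) \<noteq> UNIV" by auto
      then show ?thesis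
        using M x by (intro complement_boost_coeff_zero)
    qed (use x(1) in \<open>auto simp: clifford_on_def\<close>)
    then have "x = 0" by (intro clifford_eqI) (simp add: coeff_simps)
    then show ?thesis using x(2) by simp
  qed
  then have "boosts \<subseteq> M"
    using M unfolding reductive_splitting_spin_iff by (intro boosts_subset_subspace) auto
  then show "immirzi_complement 0 \<subseteq> M"
    by (auto simp: immirzi_complement_def)
qed

text \<open>
  For \<open>n = 3\<close> the only blade that can occur in the rotation belonging to \<open>e\<^sub>0 e\<^sub>i\<close> is the one on the
  complementary index set, and \<open>I e\<^sub>0 e\<^sub>i\<close> is plus or minus that blade.
\<close>

lemma complement_boost_pseudoscalar:
  fixes M :: "('n::{finite,linorder}) clifford set"
  assumes n: "CARD('n) = 3" and M: "reductive_splitting spin_lorentz spin_euclid M"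
  obtains \<beta> where "boost i + \<beta> *\<^sub>R (pseudoscalar * boost i) \<in> M"
proof -
  obtain x where x: "x \<in> rotations" "boost i + x \<in> M"
    using M by (rule obtain_complement_boost)
  let ?A = "UNIV - {None, Some i}"
  have cardA: "card ?A = 2"
    using n by (simp add: card_Diff_subset card_option)
  have zero: "coeff x A = 0" if "A \<noteq> ?A" for A
  proof (cases "card A = 2")
    case True
    have "insert None (insert (Some i) A) \<noteq> UNIV"
    proof
      assume "insert None (insert (Some i) A) = UNIV"
      then have "?A \<subseteq> A" by blast
      then show False
        using card_seteq [of A ?A] True cardA that by simp
    qed
    then show ?thesis
      using M x by (intro complement_boost_coeff_zero)
  qed (use x(1) in \<open>auto simp: clifford_on_def\<close>)
  let ?s = "blade_sign UNIV {None, Some i}"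
  have "sym_diff UNIV {None, Some i} = ?A" by blast
  then have I: "pseudoscalar * boost i = ?s *\<^sub>R blade ?A"
    by (simp add: boost_eq_blade blade_mult)
  have x_eq: "x = coeff x ?A *\<^sub>R blade ?A"
    using zero by (intro clifford_eqI) (auto simp: coeff_simps)
  have "(coeff x ?A * ?s) *\<^sub>R (pseudoscalar * boost i) = x"
    by (subst (2) x_eq) (simp add: I mult.assoc blade_sign_square)
  then show thesis
    using x(2) by (intro that [of "coeff x ?A * ?s"]) simp
qed

text \<open>
  The difference of the two elements is a rotation in the complement, so it vanishes; and \<open>I\<close> is
  invertible.
\<close>

lemma immirzi_parameter_unique:
  fixes M :: "('n::{finite,linorder}) clifford set"
  assumes n: "CARD('n) = 3" and M: "reductive_splitting spin_lorentz spin_euclid M"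
    and \<beta>: "boost i + \<beta> *\<^sub>R (pseudoscalar * boost i) \<in> M"
    and \<gamma>: "boost i + \<gamma> *\<^sub>R (pseudoscalar * boost i) \<in> M"
  shows "\<beta> = \<gamma>"
proof -
  let ?y = "(\<beta> - \<gamma>) *\<^sub>R (pseudoscalar * boost i)"
  have "?y = (boost i + \<beta> *\<^sub>R (pseudoscalar * boost i)) - (boost i + \<gamma> *\<^sub>R (pseudoscalar * boost i))"
    by (simp add: algebra_simps)
  then have "?y \<in> M"
    using M \<beta> \<gamma> unfolding reductive_splitting_spin_iff by (simp only: subspace_diff)
  moreover have "?y \<in> rotations"
    using n by (intro immirzi_modulo_rotations boost_in_boosts) simp
  ultimately have "?y = 0"
    using M unfolding reductive_splitting_spin_iff by blast
  moreover have "pseudoscalar * boost i \<noteq> (0 :: 'n clifford)"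
  proof
    assume "pseudoscalar * boost i = (0 :: 'n clifford)"
    moreover obtain s where "s \<noteq> 0"
      "pseudoscalar * (pseudoscalar * boost i) = s *\<^sub>R (boost i :: 'n clifford)"
      by (rule pseudoscalar_square)
    ultimately have "coeff (boost i :: 'n clifford) {None, Some i} = 0"
      by (simp add: coeff_simps)
    then show False by (simp add: boost_eq_blade coeff_simps)
  qed
  ultimately show ?thesis by simp
qed

text \<open>
  A single boost determines \<open>\<beta>\<close>; group elements that carry one axis to another, and commute with
  \<open>I\<close>, transport the relation to all boosts.
\<close>

lemma reductive_splitting_is_immirzi:
  fixes M :: "('n::{finite,linorder}) clifford set"
  assumes n: "CARD('n) = 3" and M: "reductive_splitting spin_lorentz spin_euclid M"
  shows "M \<in> range immirzi_complement"
proof -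
  \<comment> \<open>any spatial index will do, since the group permutes them\<close>
  fix i :: 'n
  have sub: "subspace M"
    using M by (simp add: reductive_splitting_spin_iff)
  obtain \<beta> where \<beta>: "boost i + \<beta> *\<^sub>R (pseudoscalar * boost i) \<in> M"
    using n M by (rule complement_boost_pseudoscalar)
  let ?T = "\<lambda>x :: 'n clifford. x + \<beta> *\<^sub>R (pseudoscalar * x)"
  have all: "?T (boost j) \<in> M" for j
  proof (cases "i = j")
    case False
    then obtain h :: "'n clifford" where h: "h \<in> spin_euclid" "Ad h (boost i) = boost j"
      by (rule Ad_rotate_boost)
    have "odd CARD('n)" using n by simp
    with h(1) have "pseudoscalar * h = h * pseudoscalar"
      unfolding spin_euclid_def by (intro pseudoscalar_commute)
    then have "Ad h (?T (boost i)) = ?T (Ad h (boost i))"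
      by (simp add: Ad_def distrib_left distrib_right flip: mult.assoc)
    then show ?thesis
      using M \<beta> h unfolding reductive_splitting_spin_iff by metis
  qed (use \<beta> in simp)
  have "boosts \<subseteq> ?T -` M"
    by (intro boosts_subset_subspace linear_subspace_vimage linear_immirzi sub) (simp add: all)
  then have "immirzi_complement \<beta> \<subseteq> M"
    by (auto simp: immirzi_complement_def)
  then have "M = immirzi_complement \<beta>"
    using n by (intro reductive_splitting_subset_eq M immirzi_complement_reductive) auto
  then show ?thesis by blast
qed

lemma independent_blades:
  "independent (range (blade :: ('n::{finite,linorder}) option set \<Rightarrow> 'n clifford))"
proof (rule independent_if_scalars_zero)
  fix f :: "'n clifford \<Rightarrow> real" and x :: "'n clifford"
  assume sum: "(\<Sum>y\<in>range (blade :: 'n option set \<Rightarrow> 'n clifford). f y *\<^sub>R y) = 0" and "x \<in> range blade"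
  from this(2) obtain A where x: "x = blade A" by (rule rangeE)
  have inj: "inj (blade :: 'n option set \<Rightarrow> 'n clifford)"
  proof (rule injI)
    fix A B :: "'n option set" assume "blade A = blade B"
    then have "coeff (blade A) A = coeff (blade B) A" by simp
    then show "A = B" by (simp add: coeff_simps split: if_splits)
  qed
  have "0 = coeff (\<Sum>B\<in>(UNIV :: 'n option set set). f (blade B) *\<^sub>R blade B) A"
    using sum by (simp add: sum.reindex [OF inj] coeff_simps o_def)
  also have "\<dots> = f x"
    by (simp add: coeff_sum coeff_simps x if_distrib cong: if_cong)
  finally show "f x = 0" by simp
qed simp

text \<open>
  The images of the boosts \<open>e\<^sub>0 e\<^sub>i\<close> under \<open>1 + \<beta> I\<close> form a frame that is affine in \<open>\<beta>\<close>.
\<close>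

lemma one_parameter_family_immirzi:
  assumes n: "CARD('n::{finite,linorder}) = 3"
  shows "one_parameter_family (immirzi_complement :: real \<Rightarrow> 'n clifford set)"
  unfolding one_parameter_family_def
proof (intro conjI)
  show "inj (immirzi_complement :: real \<Rightarrow> 'n clifford set)"
  proof (rule injI)
    fix \<beta> \<gamma> :: real
    assume eq: "immirzi_complement \<beta> = (immirzi_complement \<gamma> :: 'n clifford set)"
    fix i :: 'n
    have mem: "boost i + \<delta> *\<^sub>R (pseudoscalar * boost i) \<in> immirzi_complement \<delta>" for \<delta>
      unfolding immirzi_complement_def using boost_in_boosts by blast
    have "reductive_splitting spin_lorentz spin_euclid (immirzi_complement \<beta> :: 'n clifford set)"
      using n by (intro immirzi_complement_reductive) simp
    then show "\<beta> = \<gamma>"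
      using n mem [of \<beta>] mem [of \<gamma>] eq by (metis immirzi_parameter_unique)
  qed
  obtain f where f: "bij_betw f {..<CARD('n)} (UNIV :: 'n set)"
    using ex_bij_betw_nat_finite [of "UNIV :: 'n set"] by (auto simp: atLeast0LessThan)
  define T where "T = (\<lambda>\<beta> (x :: 'n clifford). x + \<beta> *\<^sub>R (pseudoscalar * x))"
  have range: "(\<lambda>k. T \<beta> (boost (f k))) ` {..<CARD('n)} = T \<beta> ` range boost" for \<beta>
  proof -
    have "(\<lambda>k. T \<beta> (boost (f k))) ` {..<CARD('n)} = T \<beta> ` boost ` f ` {..<CARD('n)}"
      by (simp only: image_image)
    then show ?thesis
      using f by (simp only: bij_betw_def)
  qed
  have span: "span (range boost) = (boosts :: 'n clifford set)"
  proof
    show "span (range boost) \<subseteq> (boosts :: 'n clifford set)"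
      by (intro span_minimal subspace_clifford_on) (auto intro: boost_in_boosts)
    show "(boosts :: 'n clifford set) \<subseteq> span (range boost)"
      by (intro boosts_subset_subspace) (auto intro: span_base)
  qed
  have inj: "inj_on (T \<beta>) boosts" for \<beta>
  proof (subst linear_inj_on_iff_eq_0 [OF _ subspace_clifford_on])
    show "linear (T \<beta>)" unfolding T_def by (rule linear_immirzi)
    show "\<forall>x\<in>boosts. T \<beta> x = 0 \<longrightarrow> x = 0"
    proof (intro ballI impI)
      fix x :: "'n clifford" assume "x \<in> boosts" "T \<beta> x = 0"
      then show "x = 0"
        using n immirzi_modulo_rotations(2) [of x \<beta>]
        by (simp add: T_def subspace_0 subspace_clifford_on)
    qed
  qed
  have boost_inj: "inj (boost :: 'n \<Rightarrow> 'n clifford)"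
  proof (rule injI)
    fix i j :: 'n assume "boost i = (boost j :: 'n clifford)"
    then have "coeff (boost i) {None, Some i} = coeff (boost j :: 'n clifford) {None, Some i}" by simp
    then show "i = j" by (auto simp: boost_eq_blade coeff_simps split: if_splits)
  qed
  have ind: "independent (range (boost :: 'n \<Rightarrow> 'n clifford))"
    by (rule independent_mono [OF independent_blades]) (auto simp: boost_eq_blade)
  show "\<exists>(d::nat) b. (\<forall>k<d. smooth_curve (b k)) \<and>
      (\<forall>\<beta>. inj_on (\<lambda>k. b k \<beta>) {..<d} \<and> independent ((\<lambda>k. b k \<beta>) ` {..<d}) \<and>
           (immirzi_complement \<beta> :: 'n clifford set) = span ((\<lambda>k. b k \<beta>) ` {..<d}))"
  proof (intro exI [of _ "CARD('n)"] exI [of _ "\<lambda>k \<beta>. T \<beta> (boost (f k))"] conjI allI impI)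
    show "smooth_curve (\<lambda>\<beta>. T \<beta> (boost (f k)))" for k
      unfolding T_def by (rule smooth_curve_affine)
    fix \<beta>
    have lin: "linear (T \<beta>)" unfolding T_def by (rule linear_immirzi)
    have "inj_on (T \<beta> \<circ> (boost \<circ> f)) {..<CARD('n)}"
    proof (intro comp_inj_on)
      show "inj_on f {..<CARD('n)}" using f by (simp add: bij_betw_def)
      show "inj_on boost (f ` {..<CARD('n)})" using boost_inj by (rule inj_on_subset) simp
      show "inj_on (T \<beta>) ((boost \<circ> f) ` {..<CARD('n)})"
        using inj by (rule inj_on_subset) (auto intro: boost_in_boosts)
    qed
    then show "inj_on (\<lambda>k. T \<beta> (boost (f k))) {..<CARD('n)}"
      by (simp add: o_def)
    show "independent ((\<lambda>k. T \<beta> (boost (f k))) ` {..<CARD('n)})"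
      unfolding range using inj by (intro linear_independent_injective_image lin ind) (simp add: span)
    show "immirzi_complement \<beta> = span ((\<lambda>k. T \<beta> (boost (f k))) ` {..<CARD('n)})"
      unfolding range linear_span_image [OF lin] span
      by (simp add: immirzi_complement_def T_def)
  qed
qed

theorem theorem4:
  shows "(CARD('n::{finite,linorder}) > 3 \<longrightarrow>
            (\<exists>!M :: 'n clifford set. reductive_splitting spin_lorentz spin_euclid M)) \<and>
         (CARD('n) = 3 \<longrightarrow>
            (\<exists>M :: real \<Rightarrow> 'n clifford set. one_parameter_family M \<and>
               range M = {N. reductive_splitting spin_lorentz spin_euclid N}))"
proof (intro conjI impI)
  assume "CARD('n) > 3"
  then show "\<exists>!M :: 'n clifford set. reductive_splitting spin_lorentz spin_euclid M"
    by (intro ex1I [of _ "immirzi_complement 0"] immirzi_complement_reductive unique_reductive_splitting) auto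
next
  assume n: "CARD('n) = 3"
  have "range immirzi_complement = {N :: 'n clifford set. reductive_splitting spin_lorentz spin_euclid N}"
    using reductive_splitting_is_immirzi [OF n] immirzi_complement_reductive n by blast
  with one_parameter_family_immirzi [OF n]
  show "\<exists>M :: real \<Rightarrow> 'n clifford set. one_parameter_family M \<and>
      range M = {N. reductive_splitting spin_lorentz spin_euclid N}"
    by blast
qed

end
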